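(* Let $\Gamma$ be the free group on an arbitrary set of symbols $L$, let $T$ be the automorphism of $\Gamma$ induced by an arbitrary bijection $L\to L$, and let $(A,\alpha)$ be the dual system of $(\Gamma,T)$. Let $E:A\to B$ be the conditional expectation of $A$ onto the finite orbit algebra $B$ of $(A,\alpha)$ satisfying $E\lambda(g)=\lambda(g)$ for $g\in F$ and $E\lambda(g)=0$ for $g\in\Gamma\setminus F$. Then $(A,\alpha)$ is $(E,S)$-mixing of all orders, where $S$ is the set of all states on $A$ given by density matrices on $H$.
   Context: $\Gamma$ carries the discrete topology, $H:=L^2(\Gamma)$ with respect to counting measure, and $\lambda$ is the left regular representation, $[\lambda(g)f](h)=f(g^{-1}h)$. $A:=C_r^*(\Gamma)$ is the reduced group C*-algebra, i.e. the C*-subalgebra of $B(H)$ generated by $\{\lambda(g):g\in\Gamma\}$. The automorphism $T$ induces the $*$-automorphism $\alpha$ of $A$ with $\alpha(\lambda(g))=\lambda(Tg)$; $(A,\alpha)$ is called the dual system of $(\Gamma,T)$. $F:=\{g\in\Gamma:\{T^ng:n\in\mathbb{N}\}\text{ is finite}\}$, where $\mathbb{N}=\{1,2,3,\dots\}$, a subgroup of $\Gamma$. The finite orbit algebra $B$ is the C*-subalgebra of $A$ generated by $\{\lambda(g):g\in F\}$. A conditional expectation $E$ with the stated values on $\lambda(g)$ exists (and is determined by these values). A state $\varphi$ on $A$ is given by a density matrix if $\varphi(a)=\operatorname{Tr}(\rho a)$ for all $a\in A$, where $\rho\ge0$ is a trace-class operator on $H$ with $\operatorname{Tr}(\rho)=1$.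 $(E,S)$-mixing of order $k$: for a linear map $E:A\to A$ and a set $S$ of bounded linear functionals on $A$, $(A,\alpha)$ is $(E,S)$-mixing of order $k$ if $$\lim_{\bar n^{(k)}\to\infty}\varphi\Big(\alpha^{n_{p(1)}}(a_1)\cdots\alpha^{n_{p(k)}}(a_k)-\alpha^{n_{p(1)}}(Ea_1)\cdots\alpha^{n_{p(k)}}(Ea_k)\Big)=0$$ for all $a_1,\dots,a_k\in A$, all permutations $p\in S_k$ of $\{1,\dots,k\}$ and all $\varphi\in S$, where $\bar n^{(k)}\to\infty$ means that $n_1,\,n_2-n_1,\,n_3-n_2,\dots,n_k-n_{k-1}\to\infty$. It is $(E,S)$-mixing of all orders if this holds for every $k=1,2,3,\dots$. *)

theory Defs
  imports
    "HOL-Analysis.Analysis"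
    "HOL-Algebra.Group"
    "HOL-Library.Function_Algebras"
    "HOL-Library.Nonpos_Ints"
begin

section \<open>The free group on a set of symbols\<close>

text \<open>
  A letter \<open>(x, True)\<close> stands for the generator \<open>x\<close>, and \<open>(x, False)\<close> for its formal inverse.
  Group elements are the reduced words over \<open>L\<close>; \<open>L\<close> may be empty, finite or infinite.
\<close>

type_synonym 'a letter = "'a \<times> bool"

definition flip_letter :: "'a letter \<Rightarrow> 'a letter" where
  "flip_letter a = (fst a, \<not> snd a)"

definition reduced_word :: "'a letter list \<Rightarrow> bool" where
  "reduced_word w \<longleftrightarrow> successively (\<lambda>a b. b \<noteq> flip_letter a) w"

fun push_letter :: "'a letter \<Rightarrow> 'a letter list \<Rightarrow> 'a letter list" where
  "push_letter a [] = [a]"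
| "push_letter a (b # w) = (if b = flip_letter a then w else a # b # w)"

text \<open>For reduced \<open>u\<close> and \<open>v\<close>, pushing the letters of \<open>u\<close> onto \<open>v\<close> from right to left yields
  the reduced form of the concatenation \<open>u @ v\<close>.\<close>

definition free_group :: "'a set \<Rightarrow> 'a letter list monoid" where
  "free_group L =
     \<lparr> carrier = {w. fst ` set w \<subseteq> L \<and> reduced_word w},
       mult = (\<lambda>u v. foldr push_letter u v),
       one = [] \<rparr>"

definition free_group_map :: "('a \<Rightarrow> 'a) \<Rightarrow> 'a letter list \<Rightarrow> 'a letter list" where
  "free_group_map \<sigma> w = map (apfst \<sigma>) w"

lemma flip_flip [simp]: "flip_letter (flip_letter a) = a"
  by (simp add: flip_letter_def)

lemma fst_flip [simp]: "fst (flip_letter a) = fst a"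
  by (simp add: flip_letter_def)

lemma flip_neq [simp]: "flip_letter a \<noteq> a" "a \<noteq> flip_letter a"
  by (auto simp: flip_letter_def prod_eq_iff)

lemma reduced_Nil [simp]: "reduced_word []"
  by (simp add: reduced_word_def)

lemma reduced_Cons:
  "reduced_word (a # w) \<longleftrightarrow> (w = [] \<or> hd w \<noteq> flip_letter a) \<and> reduced_word w"
  by (auto simp: reduced_word_def successively_Cons)

lemma reduced_push [simp]: "reduced_word w \<Longrightarrow> reduced_word (push_letter a w)"
  by (cases w) (auto simp: reduced_Cons)

lemma reduced_foldr_push [simp]: "reduced_word w \<Longrightarrow> reduced_word (foldr push_letter u w)"
  by (induction u) auto

lemma letters_push: "fst ` set (push_letter a w) \<subseteq> insert (fst a) (fst ` set w)"
  by (cases w) auto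

lemma letters_foldr_push: "fst ` set (foldr push_letter u w) \<subseteq> fst ` set u \<union> fst ` set w"
proof (induction u)
  case (Cons a u)
  have "fst ` set (foldr push_letter (a # u) w) \<subseteq> insert (fst a) (fst ` set (foldr push_letter u w))"
    using letters_push[of a "foldr push_letter u w"] by simp
  also have "\<dots> \<subseteq> fst ` set (a # u) \<union> fst ` set w"
    using Cons by auto
  finally show ?case .
qed simp

lemma push_push_flip: "reduced_word w \<Longrightarrow> push_letter a (push_letter (flip_letter a) w) = w"
proof (cases w)
  case (Cons b v)
  assume "reduced_word w"
  then show ?thesis using Cons by (cases v) (auto simp: reduced_Cons)
qed simp

lemma push_eq_Cons: "reduced_word (a # w) \<Longrightarrow> push_letter a w = a # w"
  by (cases w) (auto simp: reduced_Cons)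

lemma foldr_push_push:
  assumes "reduced_word w"
  shows "foldr push_letter (push_letter a v) w = push_letter a (foldr push_letter v w)"
  using assms by (cases v) (auto simp: push_push_flip)

lemma foldr_push_assoc:
  assumes "reduced_word w"
  shows "foldr push_letter (foldr push_letter u v) w = foldr push_letter u (foldr push_letter v w)"
  using assms by (induction u) (auto simp: foldr_push_push)

lemma foldr_push_inverse: "foldr push_letter (rev (map flip_letter u)) u = []"
  by (induction u) auto

lemma reduced_inverse: "reduced_word u \<Longrightarrow> reduced_word (rev (map flip_letter u))"
  unfolding reduced_word_def successively_rev successively_map
  by (erule successively_mono) (auto simp: flip_letter_def)

lemma group_free_group: "group (free_group L)"
proof (rule groupI)
  fix x y assume "x \<in> carrier (free_group L)" "y \<in> carrier (free_group L)"
  then have "fst ` set x \<union> fst ` set y \<subseteq> L" "reduced_word (foldr push_letter x y)"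
    by (simp_all add: free_group_def)
  then show "x \<otimes>\<^bsub>free_group L\<^esub> y \<in> carrier (free_group L)"
    using subset_trans[OF letters_foldr_push[of x y]] by (simp add: free_group_def)
next
  fix x assume x: "x \<in> carrier (free_group L)"
  have "rev (map flip_letter x) \<in> carrier (free_group L)"
    using x by (auto simp: free_group_def reduced_inverse image_subset_iff)
  moreover have "rev (map flip_letter x) \<otimes>\<^bsub>free_group L\<^esub> x = \<one>\<^bsub>free_group L\<^esub>"
    using foldr_push_inverse by (simp add: free_group_def)
  ultimately show "\<exists>y\<in>carrier (free_group L). y \<otimes>\<^bsub>free_group L\<^esub> x = \<one>\<^bsub>free_group L\<^esub>"
    by blast
qed (auto simp: free_group_def foldr_push_assoc)

lemma flip_apfst: "flip_letter (apfst \<sigma> a) = apfst \<sigma> (flip_letter a)"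
  by (cases a) (simp add: flip_letter_def)

lemma reduced_free_group_map:
  assumes "inj_on \<sigma> L" "fst ` set w \<subseteq> L" "reduced_word w"
  shows "reduced_word (free_group_map \<sigma> w)"
  using assms(2,3)
proof (induction w)
  case (Cons a w)
  then show ?case using assms(1)
    by (cases w) (auto simp: free_group_map_def reduced_Cons flip_letter_def prod_eq_iff inj_on_eq_iff)
qed (simp add: free_group_map_def)

lemma free_group_map_push:
  assumes "inj_on \<sigma> L" "fst a \<in> L" "fst ` set w \<subseteq> L"
  shows "free_group_map \<sigma> (push_letter a w) = push_letter (apfst \<sigma> a) (free_group_map \<sigma> w)"
  using assms
  by (cases w) (auto simp: free_group_map_def flip_letter_def prod_eq_iff inj_on_eq_iff)

lemma free_group_map_foldr_push:
  assumes "inj_on \<sigma> L" "fst ` set u \<subseteq> L" "fst ` set w \<subseteq> L"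
  shows "free_group_map \<sigma> (foldr push_letter u w) =
           foldr push_letter (free_group_map \<sigma> u) (free_group_map \<sigma> w)"
  using assms(2)
proof (induction u)
  case (Cons a u)
  have "fst ` set (foldr push_letter u w) \<subseteq> L"
    using subset_trans[OF letters_foldr_push[of u w]] Cons.prems assms(3) by simp
  then show ?case using Cons assms(1)
    by (simp add: free_group_map_push free_group_map_def[of \<sigma> "a # u"] free_group_map_def[of \<sigma> u])
qed (simp add: free_group_map_def)

lemma free_group_map_iso:
  assumes "bij_betw \<sigma> L L"
  shows "free_group_map \<sigma> \<in> iso (free_group L) (free_group L)"
proof (rule isoI)
  have inj: "inj_on \<sigma> L" using assms by (simp add: bij_betw_def)
  have closed: "free_group_map \<tau> w \<in> carrier (free_group L)"
    if "w \<in> carrier (free_group L)" "bij_betw \<tau> L L" for w and \<tau> :: "'a \<Rightarrow> 'a"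
  proof -
    have "inj_on \<tau> L" "\<tau> ` L = L" and w: "fst ` set w \<subseteq> L" "reduced_word w"
      using that by (simp_all add: free_group_def bij_betw_def)
    then have "reduced_word (free_group_map \<tau> w)"
      by (intro reduced_free_group_map)
    moreover have "fst ` set (free_group_map \<tau> w) = \<tau> ` fst ` set w"
      by (simp add: free_group_map_def image_image)
    then have "fst ` set (free_group_map \<tau> w) \<subseteq> L"
      using image_mono[OF w(1), of \<tau>] \<open>\<tau> ` L = L\<close> by simp
    ultimately show ?thesis by (simp add: free_group_def)
  qed
  show "free_group_map \<sigma> \<in> hom (free_group L) (free_group L)"
  proof (rule homI)
    fix x y assume "x \<in> carrier (free_group L)" "y \<in> carrier (free_group L)"
    then show "free_group_map \<sigma> (x \<otimes>\<^bsub>free_group L\<^esub> y) =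
        free_group_map \<sigma> x \<otimes>\<^bsub>free_group L\<^esub> free_group_map \<sigma> y"
      using free_group_map_foldr_push[OF inj] by (auto simp: free_group_def)
  qed (use closed assms in blast)
  define \<tau> where "\<tau> = inv_into L \<sigma>"
  have \<tau>: "bij_betw \<tau> L L" unfolding \<tau>_def by (rule bij_betw_inv_into[OF assms])
  have 1: "free_group_map \<tau> (free_group_map \<sigma> w) = w" if "w \<in> carrier (free_group L)" for w
    using that assms
    by (auto simp: free_group_def free_group_map_def \<tau>_def bij_betw_def intro!: map_idI)
  have 2: "free_group_map \<sigma> (free_group_map \<tau> w) = w" if "w \<in> carrier (free_group L)" for w
    using that assms
    by (auto simp: free_group_def free_group_map_def \<tau>_def bij_betw_def f_inv_into_f intro!: map_idI)
  show "bij_betw (free_group_map \<sigma>) (carrier (free_group L)) (carrier (free_group L))"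
    by (rule bij_betw_byWitness[where f' = "free_group_map \<tau>"])
       (use 1 2 closed[OF _ assms] closed[OF _ \<tau>] in auto)
qed


section \<open>Bounded operators on square-summable functions\<close>

text \<open>
  Addition, subtraction and \<open>0\<close> of vectors and of operators are the pointwise ones.
  The product of operators is composition.
  To have \<open>a = b\<close> mean equality of maps on \<open>L2 X\<close>, vectors are \<open>0\<close> outside the index set
  \<open>X\<close> and operators are \<open>0\<close> outside \<open>L2 X\<close>.
  The inner product is linear in its second argument.
\<close>

type_synonym 'g vec = "'g \<Rightarrow> complex"
type_synonym 'g op = "'g vec \<Rightarrow> 'g vec"

definition L2 :: "'g set \<Rightarrow> 'g vec set" where
  "L2 X = {f. (\<lambda>x. (cmod (f x))\<^sup>2) summable_on X \<and> (\<forall>x. x \<notin> X \<longrightarrow> f x = 0)}"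

definition L2_inner :: "'g set \<Rightarrow> 'g vec \<Rightarrow> 'g vec \<Rightarrow> complex" where
  "L2_inner X f g = (\<Sum>\<^sub>\<infinity>x\<in>X. cnj (f x) * g x)"

definition L2_norm :: "'g set \<Rightarrow> 'g vec \<Rightarrow> real" where
  "L2_norm X f = sqrt (\<Sum>\<^sub>\<infinity>x\<in>X. (cmod (f x))\<^sup>2)"

definition delta :: "'g \<Rightarrow> 'g vec" where
  "delta x = (\<lambda>y. if y = x then 1 else 0)"

definition vec_scale :: "complex \<Rightarrow> 'g vec \<Rightarrow> 'g vec" where
  "vec_scale c f = (\<lambda>x. c * f x)"

definition op_scale :: "complex \<Rightarrow> 'g op \<Rightarrow> 'g op" where
  "op_scale c a = (\<lambda>f. vec_scale c (a f))"

definition bounded_ops :: "'g set \<Rightarrow> 'g op set" where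
  "bounded_ops X = {a.
     (\<forall>f. f \<notin> L2 X \<longrightarrow> a f = 0) \<and>
     (\<forall>f\<in>L2 X. a f \<in> L2 X) \<and>
     (\<forall>f\<in>L2 X. \<forall>g\<in>L2 X. a (f + g) = a f + a g) \<and>
     (\<forall>c. \<forall>f\<in>L2 X. a (vec_scale c f) = vec_scale c (a f)) \<and>
     (\<exists>C. \<forall>f\<in>L2 X. L2_norm X (a f) \<le> C * L2_norm X f)}"

definition id_op :: "'g set \<Rightarrow> 'g op" where
  "id_op X = (\<lambda>f. if f \<in> L2 X then f else 0)"

definition op_norm :: "'g set \<Rightarrow> 'g op \<Rightarrow> real" where
  "op_norm X a = (SUP f\<in>{f \<in> L2 X. L2_norm X f \<le> 1}. L2_norm X (a f))"

definition is_adjoint :: "'g set \<Rightarrow> 'g op \<Rightarrow> 'g op \<Rightarrow> bool" where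
  "is_adjoint X a b \<longleftrightarrow> a \<in> bounded_ops X \<and> b \<in> bounded_ops X \<and>
     (\<forall>f\<in>L2 X. \<forall>g\<in>L2 X. L2_inner X (b f) g = L2_inner X f (a g))"

definition positive_op :: "'g set \<Rightarrow> 'g op \<Rightarrow> bool" where
  "positive_op X a \<longleftrightarrow> a \<in> bounded_ops X \<and> (\<forall>f\<in>L2 X. L2_inner X f (a f) \<in> \<real>\<^sub>\<ge>\<^sub>0)"

definition op_trace :: "'g set \<Rightarrow> 'g op \<Rightarrow> complex" where
  "op_trace X a = (\<Sum>\<^sub>\<infinity>x\<in>X. L2_inner X (delta x) (a (delta x)))"

text \<open>A positive operator equals its own absolute value, so it is trace-class iff its diagonal
  with respect to an orthonormal basis is summable.\<close>

definition density_matrix :: "'g set \<Rightarrow> 'g op \<Rightarrow> bool" where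
  "density_matrix X \<rho> \<longleftrightarrow> positive_op X \<rho> \<and>
     (\<lambda>x. L2_inner X (delta x) (\<rho> (delta x))) summable_on X \<and> op_trace X \<rho> = 1"


section \<open>C*-algebras of operators\<close>

definition cstar_subalgebra :: "'g set \<Rightarrow> 'g op set \<Rightarrow> bool" where
  "cstar_subalgebra X A \<longleftrightarrow>
     A \<subseteq> bounded_ops X \<and>
     0 \<in> A \<and>
     (\<forall>a\<in>A. \<forall>b\<in>A. a + b \<in> A) \<and>
     (\<forall>c. \<forall>a\<in>A. op_scale c a \<in> A) \<and>
     (\<forall>a\<in>A. \<forall>b\<in>A. a \<circ> b \<in> A) \<and>
     (\<forall>a\<in>A. \<forall>b. is_adjoint X a b \<longrightarrow> b \<in> A) \<and>
     (\<forall>s a. (\<forall>n. s n \<in> A) \<and> a \<in> bounded_ops X \<and>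
            (\<lambda>n::nat. op_norm X (s n - a)) \<longlonglongrightarrow> 0 \<longrightarrow> a \<in> A)"

definition generated_cstar :: "'g set \<Rightarrow> 'g op set \<Rightarrow> 'g op set" where
  "generated_cstar X M = cstar_subalgebra X hull M"

definition linear_map_on :: "'g op set \<Rightarrow> ('g op \<Rightarrow> 'g op) \<Rightarrow> bool" where
  "linear_map_on A \<theta> \<longleftrightarrow>
     (\<forall>a\<in>A. \<forall>b\<in>A. \<theta> (a + b) = \<theta> a + \<theta> b) \<and>
     (\<forall>c. \<forall>a\<in>A. \<theta> (op_scale c a) = op_scale c (\<theta> a))"

definition star_automorphism :: "'g set \<Rightarrow> 'g op set \<Rightarrow> ('g op \<Rightarrow> 'g op) \<Rightarrow> bool" where
  "star_automorphism X A \<alpha> \<longleftrightarrow>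
     bij_betw \<alpha> A A \<and>
     linear_map_on A \<alpha> \<and>
     (\<forall>a\<in>A. \<forall>b\<in>A. \<alpha> (a \<circ> b) = \<alpha> a \<circ> \<alpha> b) \<and>
     (\<forall>a\<in>A. \<forall>b. is_adjoint X a b \<longrightarrow> is_adjoint X (\<alpha> a) (\<alpha> b))"

text \<open>Complete positivity is automatic for such maps.\<close>

definition conditional_expectation ::
    "'g set \<Rightarrow> 'g op set \<Rightarrow> 'g op set \<Rightarrow> ('g op \<Rightarrow> 'g op) \<Rightarrow> bool" where
  "conditional_expectation X A B E \<longleftrightarrow>
     linear_map_on A E \<and>
     (\<forall>a\<in>A. E a \<in> B) \<and>
     (\<forall>b\<in>B. E b = b) \<and>
     (\<forall>a\<in>A. \<forall>b\<in>B. E (a \<circ> b) = E a \<circ> b \<and> E (b \<circ> a) = b \<circ> E a) \<and>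
     (\<forall>a\<in>A. positive_op X a \<longrightarrow> positive_op X (E a)) \<and>
     (\<forall>a\<in>A. op_norm X (E a) \<le> op_norm X a)"

definition bounded_functional :: "'g set \<Rightarrow> 'g op set \<Rightarrow> ('g op \<Rightarrow> complex) \<Rightarrow> bool" where
  "bounded_functional X A \<phi> \<longleftrightarrow>
     (\<forall>a\<in>A. \<forall>b\<in>A. \<phi> (a + b) = \<phi> a + \<phi> b) \<and>
     (\<forall>c. \<forall>a\<in>A. \<phi> (op_scale c a) = c * \<phi> a) \<and>
     (\<exists>C. \<forall>a\<in>A. cmod (\<phi> a) \<le> C * op_norm X a)"

text \<open>States on a C*-algebra containing the identity operator.\<close>

definition state :: "'g set \<Rightarrow> 'g op set \<Rightarrow> ('g op \<Rightarrow> complex) \<Rightarrow> bool" where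
  "state X A \<phi> \<longleftrightarrow> bounded_functional X A \<phi> \<and>
     (\<forall>a\<in>A. positive_op X a \<longrightarrow> \<phi> a \<in> \<real>\<^sub>\<ge>\<^sub>0) \<and> \<phi> (id_op X) = 1"

definition density_states :: "'g set \<Rightarrow> 'g op set \<Rightarrow> ('g op \<Rightarrow> complex) set" where
  "density_states X A =
     {\<phi>. state X A \<phi> \<and> (\<exists>\<rho>. density_matrix X \<rho> \<and> (\<forall>a\<in>A. \<phi> a = op_trace X (\<rho> \<circ> a)))}"


section \<open>Dual systems and finite orbit algebras\<close>

definition reg_rep :: "('g, 'm) monoid_scheme \<Rightarrow> 'g \<Rightarrow> 'g op" where
  "reg_rep G g = (\<lambda>f. if f \<in> L2 (carrier G)
     then (\<lambda>h. if h \<in> carrier G then f (inv\<^bsub>G\<^esub> g \<otimes>\<^bsub>G\<^esub> h) else 0) else 0)"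

definition reduced_cstar :: "('g, 'm) monoid_scheme \<Rightarrow> 'g op set" where
  "reduced_cstar G = generated_cstar (carrier G) (reg_rep G ` carrier G)"

definition is_dual_automorphism ::
    "('g, 'm) monoid_scheme \<Rightarrow> ('g \<Rightarrow> 'g) \<Rightarrow> ('g op \<Rightarrow> 'g op) \<Rightarrow> bool" where
  "is_dual_automorphism G T \<alpha> \<longleftrightarrow>
     star_automorphism (carrier G) (reduced_cstar G) \<alpha> \<and>
     (\<forall>g\<in>carrier G. \<alpha> (reg_rep G g) = reg_rep G (T g))"

definition finite_orbit_points :: "('g, 'm) monoid_scheme \<Rightarrow> ('g \<Rightarrow> 'g) \<Rightarrow> 'g set" where
  "finite_orbit_points G T = {g \<in> carrier G. finite {(T ^^ n) g |n. n \<ge> 1}}"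

definition finite_orbit_algebra :: "('g, 'm) monoid_scheme \<Rightarrow> ('g \<Rightarrow> 'g) \<Rightarrow> 'g op set" where
  "finite_orbit_algebra G T = generated_cstar (carrier G) (reg_rep G ` finite_orbit_points G T)"


section \<open>Mixing\<close>

text \<open>Only the values \<open>n 1, \<dots>, n k\<close> of a multi-index matter: the filter says that
  \<open>n 1\<close> and all differences \<open>n 2 - n 1, \<dots>, n k - n (k - 1)\<close> tend to infinity.\<close>

definition gaps_at_top :: "nat \<Rightarrow> (nat \<Rightarrow> nat) filter" where
  "gaps_at_top k = inf (filtercomap (\<lambda>n. n 1) at_top)
     (INF j\<in>{1..<k}. filtercomap (\<lambda>n. int (n (j + 1)) - int (n j)) at_top)"

definition ordered_product :: "'g set \<Rightarrow> nat \<Rightarrow> (nat \<Rightarrow> 'g op) \<Rightarrow> 'g op" where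
  "ordered_product X k b = foldr (\<circ>) (map b [1..<k + 1]) (id_op X)"

definition mixing_of_order ::
    "'g set \<Rightarrow> 'g op set \<Rightarrow> ('g op \<Rightarrow> 'g op) \<Rightarrow> ('g op \<Rightarrow> 'g op) \<Rightarrow> ('g op \<Rightarrow> complex) set \<Rightarrow> nat \<Rightarrow> bool"
  where
  "mixing_of_order X A \<alpha> E S k \<longleftrightarrow>
     (\<forall>a p \<phi>. (\<forall>i\<in>{1..k}. a i \<in> A) \<and> p permutes {1..k} \<and> \<phi> \<in> S \<longrightarrow>
       ((\<lambda>n. \<phi> (ordered_product X k (\<lambda>i. (\<alpha> ^^ n (p i)) (a i)) -
                  ordered_product X k (\<lambda>i. (\<alpha> ^^ n (p i)) (E (a i))))) \<longlongrightarrow> 0) (gaps_at_top k))"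

definition mixing_of_all_orders ::
    "'g set \<Rightarrow> 'g op set \<Rightarrow> ('g op \<Rightarrow> 'g op) \<Rightarrow> ('g op \<Rightarrow> 'g op) \<Rightarrow> ('g op \<Rightarrow> complex) set \<Rightarrow> bool"
  where
  "mixing_of_all_orders X A \<alpha> E S \<longleftrightarrow> (\<forall>k\<ge>1. mixing_of_order X A \<alpha> E S k)"

end

(*
  By multilinearity and contractivity of alpha and E it suffices to treat generators a_i = lambda(g_i). If
  every g_i lies in F the two products agree. Otherwise the second product vanishes and the first is
  lambda(h_n) with h_n the product of the words T^(n_p(i)) g_i, so that one needs h_n to leave every
  finite set: the matrix coefficients of a density matrix then make Tr(rho lambda(h_n)) tend to 0.
  If g_i contains a letter x with infinite sigma-orbit, then as the gaps grow sigma^(n_p(i)) x occurs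
  neither in the other factors nor in a fixed word w, so h_n = w would express T^(n_p(i)) g_i through
  words that avoid one of its letters.

  Boundedness of alpha is not part of the definition of a *-automorphism. Contractivity is derived from
  a square root of 1 - a* a in A, so that completeness of the bounded operators is needed.
*)

theory Submission
  imports Defs
begin

section \<open>Square-summable functions\<close>

text \<open>Contractivity is needed uniformly in the times: replacing one factor by a nearby
  combination of generators must cost an error independent of \<open>n\<close>, and a norm bound
  valid for every power of \<alpha> provides this. The square root serves because 1 - a* a = b b
  with b self-adjoint turns, under a unital star endomorphism \<theta>, into ||\<theta>(a) f||^2 +
  ||\<theta>(b) f||^2 = ||f||^2. Adjoints are a relation here, and closure under adjoints only
  concerns those that exist. Existence is proved for the generated algebra: the operators of the
  group elements are closed under product and adjoint, so the algebra is their closed linear span,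
  and having an adjoint survives limits, again by completeness. The same description lets density
  arguments run over closed subspaces. Density matrices are treated through their matrix entries
  alone. Positivity bounds an off-diagonal entry by a weighted mean of two diagonal entries, and the
  weights can be chosen separately for each entry.\<close>

lemma
  assumes "\<And>x. x \<notin> X \<Longrightarrow> f x = 0"
    and "\<And>K. finite K \<Longrightarrow> K \<subseteq> X \<Longrightarrow> L2_set (\<lambda>x. cmod (f x)) K \<le> c"
  shows L2I: "f \<in> L2 X" and L2_norm_leI: "L2_norm X f \<le> c"
proof -
  have sums: "(\<Sum>x\<in>K. (cmod (f x))\<^sup>2) \<le> c\<^sup>2" if "finite K" "K \<subseteq> X" for K
    using assms(2)[OF that] by (simp add: L2_set_def sqrt_le_D)
  have summ: "(\<lambda>x. (cmod (f x))\<^sup>2) summable_on X"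
    by (rule nonneg_bdd_above_summable_on) (auto intro!: bdd_aboveI2[where M = "c\<^sup>2"] sums)
  then show "f \<in> L2 X"
    using assms(1) by (simp add: L2_def)
  have "(\<Sum>\<^sub>\<infinity>x\<in>X. (cmod (f x))\<^sup>2) \<le> c\<^sup>2"
    by (rule infsum_le_finite_sums[OF summ sums])
  moreover have "c \<ge> 0"
    using assms(2)[of "{}"] by simp
  ultimately show "L2_norm X f \<le> c"
    by (simp add: L2_norm_def real_le_lsqrt infsum_nonneg)
qed

lemma L2_outside: "f \<in> L2 X \<Longrightarrow> x \<notin> X \<Longrightarrow> f x = 0"
  by (simp add: L2_def)

lemma L2_set_le_L2_norm:
  assumes "f \<in> L2 X" "finite K" "K \<subseteq> X"
  shows "L2_set (\<lambda>x. cmod (f x)) K \<le> L2_norm X f"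
  unfolding L2_set_def L2_norm_def
  using assms by (intro real_sqrt_le_mono finite_sum_le_infsum) (auto simp: L2_def)

lemma L2_norm_nonneg [simp]: "0 \<le> L2_norm X f"
  by (simp add: L2_norm_def infsum_nonneg)

lemma cmod_le_L2_norm: "f \<in> L2 X \<Longrightarrow> cmod (f x) \<le> L2_norm X f"
  using L2_set_le_L2_norm[of f X "{x}"] by (cases "x \<in> X") (auto simp: L2_set_def L2_outside)

text \<open>Minkowski's inequality on finite sets gives a bound uniform over these sets, which
  yields membership and the norm estimate together.\<close>

lemma
  assumes "f \<in> L2 X" "g \<in> L2 X"
  shows L2_add [simp]: "f + g \<in> L2 X"
    and L2_norm_triangle: "L2_norm X (f + g) \<le> L2_norm X f + L2_norm X g"
proof -
  have zero: "(f + g) x = 0" if "x \<notin> X" for x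
    using that assms by (simp add: L2_outside)
  have bound: "L2_set (\<lambda>x. cmod ((f + g) x)) K \<le> L2_norm X f + L2_norm X g"
    if K: "finite K" "K \<subseteq> X" for K
  proof -
    have "L2_set (\<lambda>x. cmod ((f + g) x)) K \<le> L2_set (\<lambda>x. cmod (f x) + cmod (g x)) K"
      by (intro L2_set_mono) (auto simp: norm_triangle_ineq)
    also have "\<dots> \<le> L2_set (\<lambda>x. cmod (f x)) K + L2_set (\<lambda>x. cmod (g x)) K"
      by (rule L2_set_triangle_ineq)
    also have "\<dots> \<le> L2_norm X f + L2_norm X g"
      using assms K by (intro add_mono L2_set_le_L2_norm)
    finally show ?thesis .
  qed
  show "f + g \<in> L2 X" "L2_norm X (f + g) \<le> L2_norm X f + L2_norm X g"
    by (rule L2I[OF zero bound] L2_norm_leI[OF zero bound]; assumption)+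
qed

lemma L2_zero [simp]: "0 \<in> L2 X"
  by (simp add: L2_def)

lemma L2_norm_zero [simp]: "L2_norm X 0 = 0"
  by (simp add: L2_norm_def)

lemma L2_scale [simp]: "f \<in> L2 X \<Longrightarrow> vec_scale c f \<in> L2 X"
  by (auto simp: L2_def vec_scale_def norm_mult power_mult_distrib intro!: summable_on_cmult_right)

lemma L2_norm_scale [simp]: "L2_norm X (vec_scale c f) = cmod c * L2_norm X f"
  by (simp add: L2_norm_def vec_scale_def norm_mult power_mult_distrib infsum_cmult_right'
      real_sqrt_mult)

lemma vec_scale_add: "vec_scale c (f + g) = vec_scale c f + vec_scale c g"
  by (simp add: vec_scale_def fun_eq_iff distrib_left)

lemma vec_scale_vec_scale: "vec_scale c (vec_scale d f) = vec_scale (c * d) f"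
  by (simp add: vec_scale_def mult.assoc)

lemma vec_scale_0 [simp]: "vec_scale c 0 = 0"
  by (simp add: vec_scale_def fun_eq_iff)

lemma minus_eq_add_scale: "f - g = f + vec_scale (- 1) g"
  by (simp add: vec_scale_def fun_eq_iff)

lemma L2_diff [simp]: "f \<in> L2 X \<Longrightarrow> g \<in> L2 X \<Longrightarrow> f - g \<in> L2 X"
  by (simp add: minus_eq_add_scale)

lemma L2_norm_eq_0: "f \<in> L2 X \<Longrightarrow> L2_norm X f = 0 \<Longrightarrow> f = 0"
  using cmod_le_L2_norm by (force simp: fun_eq_iff)

lemma delta_L2 [simp]: "x \<in> X \<Longrightarrow> delta x \<in> L2 X"
proof (rule L2I[where c = 1])
  fix K :: "'a set" assume "finite K"
  then show "L2_set (\<lambda>y. cmod (delta x y)) K \<le> 1"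
    by (auto simp: L2_set_def delta_def sum.delta if_distrib[where f = "\<lambda>c. (cmod c)\<^sup>2"] cong: if_cong)
qed (auto simp: delta_def)

text \<open>Cauchy-Schwarz on finite subsets bounds all partial sums of absolute values, so
  summability and the estimate have the same source.\<close>

lemma
  assumes "f \<in> L2 X" "g \<in> L2 X"
  shows L2_inner_abs_summable: "(\<lambda>x. cmod (cnj (f x) * g x)) summable_on X"
    and L2_inner_bound: "cmod (L2_inner X f g) \<le> L2_norm X f * L2_norm X g"
proof -
  have sums: "(\<Sum>x\<in>K. cmod (cnj (f x) * g x)) \<le> L2_norm X f * L2_norm X g"
    if "finite K" "K \<subseteq> X" for K
  proof -
    have "(\<Sum>x\<in>K. cmod (cnj (f x) * g x)) \<le> L2_set (\<lambda>x. cmod (f x)) K * L2_set (\<lambda>x. cmod (g x)) K"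
      using L2_set_mult_ineq[of "\<lambda>x. cmod (f x)" "\<lambda>x. cmod (g x)" K] by (simp add: norm_mult)
    also have "\<dots> \<le> L2_norm X f * L2_norm X g"
      using assms that by (intro mult_mono L2_set_le_L2_norm) auto
    finally show ?thesis .
  qed
  show summ: "(\<lambda>x. cmod (cnj (f x) * g x)) summable_on X"
    by (rule nonneg_bdd_above_summable_on)
      (auto intro!: bdd_aboveI2[where M = "L2_norm X f * L2_norm X g"] sums)
  show "cmod (L2_inner X f g) \<le> L2_norm X f * L2_norm X g"
    unfolding L2_inner_def
    by (rule order_trans[OF norm_infsum_bound[OF summ] infsum_le_finite_sums[OF summ sums]])
qed

lemmas L2_inner_summable = abs_summable_summable[OF L2_inner_abs_summable]

lemma L2_inner_add_right:
  "f \<in> L2 X \<Longrightarrow> g \<in> L2 X \<Longrightarrow> h \<in> L2 X \<Longrightarrow> L2_inner X f (g + h) = L2_inner X f g + L2_inner X f h"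
  by (simp add: L2_inner_def distrib_left infsum_add L2_inner_summable)

lemma L2_inner_scale_right: "L2_inner X f (vec_scale c g) = c * L2_inner X f g"
  by (simp add: L2_inner_def vec_scale_def infsum_cmult_right' mult.left_commute)

lemma L2_inner_commute: "L2_inner X g f = cnj (L2_inner X f g)"
  by (simp add: L2_inner_def mult.commute flip: infsum_cnj)

lemma L2_inner_add_left:
  "f \<in> L2 X \<Longrightarrow> g \<in> L2 X \<Longrightarrow> h \<in> L2 X \<Longrightarrow> L2_inner X (g + h) f = L2_inner X g f + L2_inner X h f"
  by (simp add: L2_inner_commute[of X _ f] L2_inner_add_right)

lemma L2_inner_scale_left: "L2_inner X (vec_scale c g) f = cnj c * L2_inner X g f"
  by (simp add: L2_inner_commute[of X _ f] L2_inner_scale_right)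

lemma L2_inner_diff_right:
  "f \<in> L2 X \<Longrightarrow> g \<in> L2 X \<Longrightarrow> h \<in> L2 X \<Longrightarrow> L2_inner X f (g - h) = L2_inner X f g - L2_inner X f h"
  by (simp add: minus_eq_add_scale L2_inner_add_right L2_inner_scale_right)

lemma L2_inner_diff_left:
  "f \<in> L2 X \<Longrightarrow> g \<in> L2 X \<Longrightarrow> h \<in> L2 X \<Longrightarrow> L2_inner X (g - h) f = L2_inner X g f - L2_inner X h f"
  by (simp add: L2_inner_commute[of X _ f] L2_inner_diff_right)

lemma L2_inner_self:
  assumes "f \<in> L2 X"
  shows "L2_inner X f f = complex_of_real ((L2_norm X f)\<^sup>2)"
proof -
  have "L2_inner X f f = (\<Sum>\<^sub>\<infinity>x\<in>X. complex_of_real ((cmod (f x))\<^sup>2))"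
    unfolding L2_inner_def complex_norm_square by (simp add: mult.commute)
  also have "\<dots> = complex_of_real (\<Sum>\<^sub>\<infinity>x\<in>X. (cmod (f x))\<^sup>2)"
    by (rule infsumI, rule has_sum_of_real, rule has_sum_infsum) (use assms in \<open>simp add: L2_def\<close>)
  finally show ?thesis
    by (simp add: L2_norm_def infsum_nonneg)
qed

lemma L2_inner_delta:
  assumes "x \<in> X"
  shows "L2_inner X (delta x) f = f x"
proof -
  have "L2_inner X (delta x) f = (\<Sum>\<^sub>\<infinity>y\<in>{x}. cnj (delta x y) * f y)"
    unfolding L2_inner_def by (rule infsum_cong_neutral) (use assms in \<open>auto simp: delta_def\<close>)
  then show ?thesis by (simp add: delta_def)
qed

section \<open>Bounded operators\<close>

lemma
  assumes "a \<in> bounded_ops X"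
  shows bounded_ops_outside: "f \<notin> L2 X \<Longrightarrow> a f = 0"
    and bounded_ops_L2 [simp]: "a f \<in> L2 X"
    and bounded_ops_add: "f \<in> L2 X \<Longrightarrow> g \<in> L2 X \<Longrightarrow> a (f + g) = a f + a g"
    and bounded_ops_scale: "f \<in> L2 X \<Longrightarrow> a (vec_scale c f) = vec_scale c (a f)"
proof -
  show *: "f \<notin> L2 X \<Longrightarrow> a f = 0"
    using assms unfolding bounded_ops_def by blast
  show "a f \<in> L2 X"
    using assms * unfolding bounded_ops_def by (cases "f \<in> L2 X") auto
qed (use assms in \<open>unfold bounded_ops_def, blast\<close>)+

lemma bounded_ops_diff:
  "a \<in> bounded_ops X \<Longrightarrow> f \<in> L2 X \<Longrightarrow> g \<in> L2 X \<Longrightarrow> a (f - g) = a f - a g"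
  using bounded_ops_add[of a X f "vec_scale (- 1) g"] bounded_ops_scale[of a X g "- 1"]
  by (simp add: minus_eq_add_scale)

lemma bounded_ops_0: "a \<in> bounded_ops X \<Longrightarrow> a 0 = 0"
  by (metis L2_zero bounded_ops_diff diff_self)

lemma bounded_ops_ext:
  assumes "a \<in> bounded_ops X" "b \<in> bounded_ops X" "\<And>f. f \<in> L2 X \<Longrightarrow> a f = b f"
  shows "a = b"
proof
  fix f show "a f = b f"
    using assms(3) bounded_ops_outside[OF assms(1)] bounded_ops_outside[OF assms(2)]
    by (cases "f \<in> L2 X") auto
qed

lemma bounded_opsI:
  assumes "\<And>f. f \<notin> L2 X \<Longrightarrow> a f = 0"
    and "\<And>f. f \<in> L2 X \<Longrightarrow> a f \<in> L2 X"
    and "\<And>f g. f \<in> L2 X \<Longrightarrow> g \<in> L2 X \<Longrightarrow> a (f + g) = a f + a g"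
    and "\<And>c f. f \<in> L2 X \<Longrightarrow> a (vec_scale c f) = vec_scale c (a f)"
    and "\<And>f. f \<in> L2 X \<Longrightarrow> L2_norm X (a f) \<le> C * L2_norm X f"
  shows "a \<in> bounded_ops X"
  using assms unfolding bounded_ops_def by blast

lemma op_norm_bdd_above:
  assumes "a \<in> bounded_ops X"
  shows "bdd_above ((\<lambda>f. L2_norm X (a f)) ` {f \<in> L2 X. L2_norm X f \<le> 1})"
proof -
  obtain C where C: "\<forall>f\<in>L2 X. L2_norm X (a f) \<le> C * L2_norm X f"
    using assms unfolding bounded_ops_def by blast
  have "L2_norm X (a f) \<le> \<bar>C\<bar>" if "f \<in> L2 X" "L2_norm X f \<le> 1" for f
  proof -
    have "C * L2_norm X f \<le> \<bar>C\<bar> * 1"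
      using that by (intro mult_mono) auto
    then show ?thesis using bspec[OF C that(1)] by linarith
  qed
  then show ?thesis
    by (intro bdd_aboveI2[where M = "\<bar>C\<bar>"]) auto
qed

lemma op_norm_bound:
  assumes a: "a \<in> bounded_ops X" and f: "f \<in> L2 X"
  shows "L2_norm X (a f) \<le> op_norm X a * L2_norm X f"
proof (cases "L2_norm X f = 0")
  case True
  then show ?thesis
    using L2_norm_eq_0[OF f] bounded_ops_0[OF a] by simp
next
  case False
  define t where "t = L2_norm X f"
  have t: "t > 0" using False L2_norm_nonneg[of X f] unfolding t_def by linarith
  define g where "g = vec_scale (complex_of_real (1 / t)) f"
  have g: "g \<in> L2 X" "L2_norm X g \<le> 1"
    using f t by (simp_all add: g_def norm_divide flip: t_def)
  have "L2_norm X (a g) \<le> op_norm X a"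
    unfolding op_norm_def by (rule cSUP_upper[OF _ op_norm_bdd_above[OF a]]) (use g in auto)
  moreover have "L2_norm X (a g) = L2_norm X (a f) / t"
    using t by (simp add: g_def bounded_ops_scale[OF a f] norm_divide)
  ultimately show ?thesis
    using t by (simp add: divide_le_eq flip: t_def)
qed

lemma op_norm_leI:
  assumes "\<And>f. f \<in> L2 X \<Longrightarrow> L2_norm X (a f) \<le> C * L2_norm X f" "C \<ge> 0"
  shows "op_norm X a \<le> C"
  unfolding op_norm_def
proof (rule cSUP_least)
  show "{f \<in> L2 X. L2_norm X f \<le> 1} \<noteq> {}"
    using L2_zero[of X] L2_norm_zero[of X] by (metis (mono_tags, lifting) empty_iff mem_Collect_eq zero_le_one)
  fix f assume "f \<in> {f \<in> L2 X. L2_norm X f \<le> 1}"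
  then show "L2_norm X (a f) \<le> C"
    using assms(1)[of f] mult_left_le[of "L2_norm X f" C] assms(2) by auto
qed

lemma op_norm_nonneg:
  assumes "a \<in> bounded_ops X"
  shows "0 \<le> op_norm X a"
proof -
  have "L2_norm X (a 0) \<le> op_norm X a"
    unfolding op_norm_def by (rule cSUP_upper[OF _ op_norm_bdd_above[OF assms]]) auto
  then show ?thesis using L2_norm_nonneg order_trans by blast
qed

lemma bounded_ops_zero [simp]: "0 \<in> bounded_ops X"
  by (rule bounded_opsI[where C = 0]) auto

lemma op_norm_zero [simp]: "op_norm X 0 = 0"
  using op_norm_leI[of X 0 0] op_norm_nonneg[of 0 X] by simp

lemma
  assumes a: "a \<in> bounded_ops X" and b: "b \<in> bounded_ops X"
  shows bounded_ops_plus [simp]: "a + b \<in> bounded_ops X"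
    and op_norm_triangle: "op_norm X (a + b) \<le> op_norm X a + op_norm X b"
proof -
  have bound: "L2_norm X ((a + b) f) \<le> (op_norm X a + op_norm X b) * L2_norm X f"
    if "f \<in> L2 X" for f
    using L2_norm_triangle[of "a f" X "b f"] op_norm_bound[OF a that] op_norm_bound[OF b that] a b
    by (simp add: distrib_right)
  show "a + b \<in> bounded_ops X"
    by (rule bounded_opsI[OF _ _ _ _ bound])
      (auto simp: bounded_ops_outside[OF a] bounded_ops_outside[OF b] bounded_ops_add[OF a]
        bounded_ops_add[OF b] bounded_ops_scale[OF a] bounded_ops_scale[OF b] a b add_ac vec_scale_add)
  show "op_norm X (a + b) \<le> op_norm X a + op_norm X b"
    by (rule op_norm_leI[OF bound]) (assumption, intro add_nonneg_nonneg mult_nonneg_nonneg op_norm_nonneg a b)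
qed

lemma
  assumes a: "a \<in> bounded_ops X"
  shows bounded_ops_op_scale [simp]: "op_scale c a \<in> bounded_ops X"
    and op_norm_scale_le: "op_norm X (op_scale c a) \<le> cmod c * op_norm X a"
proof -
  have bound: "L2_norm X (op_scale c a f) \<le> (cmod c * op_norm X a) * L2_norm X f"
    if "f \<in> L2 X" for f
    using mult_left_mono[OF op_norm_bound[OF a that], of "cmod c"]
    by (simp add: op_scale_def mult.assoc)
  show "op_scale c a \<in> bounded_ops X"
    by (rule bounded_opsI[OF _ _ _ _ bound])
      (auto simp: op_scale_def bounded_ops_outside[OF a] bounded_ops_add[OF a]
        bounded_ops_scale[OF a] a vec_scale_add vec_scale_vec_scale mult.commute)
  show "op_norm X (op_scale c a) \<le> cmod c * op_norm X a"
    by (rule op_norm_leI[OF bound]) (assumption, intro mult_nonneg_nonneg norm_ge_zero op_norm_nonneg a)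
qed

lemma
  assumes a: "a \<in> bounded_ops X" and b: "b \<in> bounded_ops X"
  shows bounded_ops_comp [simp]: "a \<circ> b \<in> bounded_ops X"
    and op_norm_comp: "op_norm X (a \<circ> b) \<le> op_norm X a * op_norm X b"
proof -
  have bound: "L2_norm X ((a \<circ> b) f) \<le> (op_norm X a * op_norm X b) * L2_norm X f"
    if f: "f \<in> L2 X" for f
  proof -
    have "L2_norm X ((a \<circ> b) f) \<le> op_norm X a * L2_norm X (b f)"
      using op_norm_bound[OF a, of "b f"] b by simp
    also have "\<dots> \<le> op_norm X a * (op_norm X b * L2_norm X f)"
      by (intro mult_left_mono op_norm_bound b f op_norm_nonneg a)
    finally show ?thesis by (simp add: mult.assoc)
  qed
  show "a \<circ> b \<in> bounded_ops X"
    by (rule bounded_opsI[OF _ _ _ _ bound])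
      (auto simp: bounded_ops_outside[OF b] bounded_ops_0[OF a] bounded_ops_add[OF a]
        bounded_ops_add[OF b] bounded_ops_scale[OF a] bounded_ops_scale[OF b] a b)
  show "op_norm X (a \<circ> b) \<le> op_norm X a * op_norm X b"
    by (rule op_norm_leI[OF bound]) (assumption, intro add_nonneg_nonneg mult_nonneg_nonneg op_norm_nonneg a b)
qed

lemma op_minus_eq_add_scale: "a - b = a + op_scale (- 1) b" for a b :: "'g op"
  by (simp add: op_scale_def vec_scale_def fun_eq_iff)

lemma bounded_ops_minus [simp]:
  "a \<in> bounded_ops X \<Longrightarrow> b \<in> bounded_ops X \<Longrightarrow> a - b \<in> bounded_ops X"
  by (simp add: op_minus_eq_add_scale)

lemma op_norm_minus_commute: "op_norm X (a - b) = op_norm X (b - a)"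
proof -
  have "(b - a) f = vec_scale (- 1) ((a - b) f)" for f
    by (simp add: vec_scale_def fun_eq_iff)
  then show ?thesis by (simp add: op_norm_def)
qed

lemma op_norm_triangle_minus:
  assumes "a \<in> bounded_ops X" "b \<in> bounded_ops X" "c \<in> bounded_ops X"
  shows "op_norm X (a - c) \<le> op_norm X (a - b) + op_norm X (b - c)"
proof -
  have "a - c = (a - b) + (b - c)" by (simp add: fun_eq_iff)
  then show ?thesis using op_norm_triangle[of "a - b" X "b - c"] assms by simp
qed

lemma id_op_bounded [simp]: "id_op X \<in> bounded_ops X"
  by (rule bounded_opsI[where C = 1]) (auto simp: id_op_def)

lemma op_norm_id_op: "op_norm X (id_op X) \<le> 1"
  by (rule op_norm_leI) (auto simp: id_op_def)

text \<open>The unit is \<open>id_op X\<close> rather than the identity function. Equality of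
  functions holds because a bounded operator takes all its values in \<open>L2 X\<close>, even at
  arguments outside it, where the value is 0.\<close>

lemma id_op_comp [simp]: "a \<in> bounded_ops X \<Longrightarrow> id_op X \<circ> a = a"
  by (auto simp: id_op_def fun_eq_iff)

lemma comp_add_left: "(a + b) \<circ> c = (a \<circ> c) + (b \<circ> c)" for a b c :: "'g op"
  by (simp add: fun_eq_iff)

lemma comp_diff_left: "(a - b) \<circ> c = (a \<circ> c) - (b \<circ> c)" for a b c :: "'g op"
  by (simp add: fun_eq_iff)

lemma comp_scale_left: "op_scale k a \<circ> c = op_scale k (a \<circ> c)"
  by (simp add: fun_eq_iff op_scale_def)

text \<open>Pointwise sums distribute by definition when the sum is the outer map. Here the sum is
  the inner map, so linearity of \<open>c\<close> enters, and that is available on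
  \<open>L2 X\<close> only.\<close>

lemma
  assumes a: "a \<in> bounded_ops X" and b: "b \<in> bounded_ops X" and c: "c \<in> bounded_ops X"
  shows comp_add_right: "c \<circ> (a + b) = (c \<circ> a) + (c \<circ> b)"
    and comp_diff_right: "c \<circ> (a - b) = (c \<circ> a) - (c \<circ> b)"
proof -
  show "c \<circ> (a + b) = (c \<circ> a) + (c \<circ> b)"
    by (rule bounded_ops_ext[of _ X]) (use a b c in \<open>simp_all add: bounded_ops_add[OF c]\<close>)
  show "c \<circ> (a - b) = (c \<circ> a) - (c \<circ> b)"
    by (rule bounded_ops_ext[of _ X]) (use a b c in \<open>simp_all add: bounded_ops_diff[OF c]\<close>)
qed

lemma comp_scale_right:
  assumes a: "a \<in> bounded_ops X" and c: "c \<in> bounded_ops X"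
  shows "c \<circ> op_scale k a = op_scale k (c \<circ> a)"
proof (rule bounded_ops_ext[of _ X])
  show "(c \<circ> op_scale k a) f = op_scale k (c \<circ> a) f" if "f \<in> L2 X" for f
    using a by (simp add: op_scale_def bounded_ops_scale[OF c])
qed (use a c in simp_all)

text \<open>The norm dominates every coordinate, so the limit is defined coordinatewise. Letting
  \<open>m\<close> tend to infinity in estimates over finite sets of coordinates gives
  square-summability and the uniform rate in one stroke.\<close>

lemma bounded_ops_complete:
  fixes s :: "nat \<Rightarrow> 'g op"
  assumes s: "\<And>n. s n \<in> bounded_ops X"
    and Cauchy: "\<And>\<epsilon>. \<epsilon> > 0 \<Longrightarrow> \<exists>N. \<forall>m\<ge>N. \<forall>n\<ge>N. op_norm X (s m - s n) \<le> \<epsilon>"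
  shows "\<exists>a\<in>bounded_ops X. (\<lambda>n. op_norm X (s n - a)) \<longlonglongrightarrow> 0"
proof -
  have le: "L2_norm X (s m f - s n f) \<le> \<epsilon> * L2_norm X f"
    if "op_norm X (s m - s n) \<le> \<epsilon>" "f \<in> L2 X" for m n \<epsilon> f
  proof -
    have "L2_norm X ((s m - s n) f) \<le> op_norm X (s m - s n) * L2_norm X f"
      by (intro op_norm_bound that bounded_ops_minus s)
    then show ?thesis
      using mult_right_mono[OF that(1) L2_norm_nonneg[of X f]] by simp
  qed
  have conv: "convergent (\<lambda>n. s n f x)" if f: "f \<in> L2 X" for f x
  proof -
    have "Cauchy (\<lambda>n. s n f x)"
    proof (rule metric_CauchyI)
      fix e :: real assume e: "e > 0"
      \<comment> \<open>The summand 1 keeps the denominator positive when the norm of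
        \<open>f\<close> is 0, and makes the estimate below strict.\<close>
      define \<epsilon> where "\<epsilon> = e / (L2_norm X f + 1)"
      have pos: "L2_norm X f + 1 > 0"
        using L2_norm_nonneg[of X f] by linarith
      then have "\<epsilon> > 0" using e by (simp add: \<epsilon>_def)
      then obtain N where N: "\<forall>m\<ge>N. \<forall>n\<ge>N. op_norm X (s m - s n) \<le> \<epsilon>"
        using Cauchy by blast
      have "dist (s m f x) (s n f x) < e" if "m \<ge> N" "n \<ge> N" for m n
      proof -
        have "dist (s m f x) (s n f x) = cmod ((s m f - s n f) x)"
          by (simp add: dist_norm)
        also have "\<dots> \<le> L2_norm X (s m f - s n f)"
          by (intro cmod_le_L2_norm L2_diff bounded_ops_L2 s)
        also have "\<dots> \<le> \<epsilon> * L2_norm X f"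
          using N that by (intro le f) auto
        also have "\<dots> < \<epsilon> * (L2_norm X f + 1)"
          using \<open>\<epsilon> > 0\<close> by simp
        also have "\<dots> = e"
          using pos by (simp add: \<epsilon>_def)
        finally show ?thesis .
      qed
      then show "\<exists>M. \<forall>m\<ge>M. \<forall>n\<ge>M. dist (s m f x) (s n f x) < e" by blast
    qed
    then show ?thesis by (rule Cauchy_convergent)
  qed
  define a where "a = (\<lambda>f x. if f \<in> L2 X then lim (\<lambda>n. s n f x) else 0)"
  have lims: "(\<lambda>n. s n f x) \<longlonglongrightarrow> a f x" if "f \<in> L2 X" for f x
    using conv[OF that, of x] that by (simp add: a_def convergent_LIMSEQ_iff)
  \<comment> \<open>The difference is treated before \<open>a f\<close> is known to be
    square-summable; membership of \<open>a f\<close> follows afterwards by subtracting it from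
    \<open>s n f\<close>.\<close>
  have a_L2_and_bound: "s n f - a f \<in> L2 X \<and> L2_norm X (s n f - a f) \<le> \<epsilon> * L2_norm X f"
    if N: "\<forall>m\<ge>N. \<forall>n\<ge>N. op_norm X (s m - s n) \<le> \<epsilon>" and n: "n \<ge> N" and f: "f \<in> L2 X"
    for N \<epsilon> n f
  proof -
    have zero: "(s n f - a f) x = 0" if x: "x \<notin> X" for x
    proof -
      have "s m f x = 0" for m
        using L2_outside[OF bounded_ops_L2[OF s] x] .
      then show ?thesis
        using LIMSEQ_unique[OF lims[OF f, of x]] by simp
    qed
    have bound: "L2_set (\<lambda>x. cmod ((s n f - a f) x)) K \<le> \<epsilon> * L2_norm X f"
      if K: "finite K" "K \<subseteq> X" for K
    proof (rule tendsto_upperbound)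
      show "(\<lambda>m. L2_set (\<lambda>x. cmod ((s n f - s m f) x)) K)
          \<longlonglongrightarrow> L2_set (\<lambda>x. cmod ((s n f - a f) x)) K"
        unfolding L2_set_def minus_apply by (intro tendsto_intros lims f)
      show "\<forall>\<^sub>F m in sequentially. L2_set (\<lambda>x. cmod ((s n f - s m f) x)) K \<le> \<epsilon> * L2_norm X f"
        using eventually_ge_at_top[of N]
      proof eventually_elim
        case (elim m)
        have "L2_set (\<lambda>x. cmod ((s n f - s m f) x)) K \<le> L2_norm X (s n f - s m f)"
          by (intro L2_set_le_L2_norm K L2_diff bounded_ops_L2 s)
        also have "\<dots> \<le> \<epsilon> * L2_norm X f"
          using N n elim by (intro le f) auto
        finally show ?case .
      qed
    qed simp
    show ?thesis
      using L2I[OF zero bound] L2_norm_leI[OF zero bound] by blast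
  qed
  have aL2: "a f \<in> L2 X" if f: "f \<in> L2 X" for f
  proof -
    obtain N where "\<forall>m\<ge>N. \<forall>n\<ge>N. op_norm X (s m - s n) \<le> 1"
      using Cauchy[of 1] by auto
    from a_L2_and_bound[OF this order_refl f]
    have "s N f - a f \<in> L2 X" ..
    from L2_diff[OF bounded_ops_L2[OF s[of N], of f] this] show ?thesis unfolding diff_diff_eq2 by (simp only: add_diff_cancel_left')
  qed
  have a: "a \<in> bounded_ops X"
  proof -
    obtain N where N: "\<forall>m\<ge>N. \<forall>n\<ge>N. op_norm X (s m - s n) \<le> 1"
      using Cauchy[of 1] by auto
    \<comment> \<open>The bound is the norm of \<open>s N\<close> plus 1, since the limit differs
      from \<open>s N\<close> by at most 1.\<close>
    show ?thesis
    proof (rule bounded_opsI[where C = "op_norm X (s N) + 1"])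
      show "a f = 0" if "f \<notin> L2 X" for f
        using that by (simp add: a_def fun_eq_iff)
      show "a f \<in> L2 X" if "f \<in> L2 X" for f
        using that by (rule aL2)
      show "a (f + g) = a f + a g" if "f \<in> L2 X" "g \<in> L2 X" for f g
      proof
        fix x
        have "(\<lambda>n. s n f x + s n g x) \<longlonglongrightarrow> a (f + g) x"
          using lims[of "f + g" x] that by (simp add: bounded_ops_add[OF s])
        then show "a (f + g) x = (a f + a g) x"
          using LIMSEQ_unique[OF _ tendsto_add[OF lims[OF that(1)] lims[OF that(2)]]] by simp
      qed
      show "a (vec_scale c f) = vec_scale c (a f)" if "f \<in> L2 X" for c f
      proof
        fix x
        have "(\<lambda>n. c * s n f x) \<longlonglongrightarrow> a (vec_scale c f) x"
          using lims[of "vec_scale c f" x] that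
          by (simp add: bounded_ops_scale[OF s] vec_scale_def[of c "s _ f"])
        then show "a (vec_scale c f) x = vec_scale c (a f) x"
          using LIMSEQ_unique[OF _ tendsto_mult[OF tendsto_const lims[OF that]]]
          by (simp add: vec_scale_def[of c "a f"])
      qed
      show "L2_norm X (a f) \<le> (op_norm X (s N) + 1) * L2_norm X f" if f: "f \<in> L2 X" for f
      proof -
        have "L2_norm X (s N f + vec_scale (- 1) (s N f - a f))
            \<le> L2_norm X (s N f) + L2_norm X (vec_scale (- 1) (s N f - a f))"
          using a_L2_and_bound[OF N order_refl f] s by (intro L2_norm_triangle) auto
        also have "s N f + vec_scale (- 1) (s N f - a f) = a f"
          by (simp add: vec_scale_def fun_eq_iff)
        also have "L2_norm X (vec_scale (- 1) (s N f - a f)) \<le> 1 * L2_norm X f"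
          using a_L2_and_bound[OF N order_refl f] by simp
        finally show ?thesis
          using op_norm_bound[OF s f, of N] by (simp add: distrib_right)
      qed
    qed
  qed
  moreover have "(\<lambda>n. op_norm X (s n - a)) \<longlonglongrightarrow> 0"
  proof (rule LIMSEQ_I)
    fix r :: real assume r: "r > 0"
    then obtain N where N: "\<forall>m\<ge>N. \<forall>n\<ge>N. op_norm X (s m - s n) \<le> r / 2"
      using Cauchy[of "r / 2"] by auto
    have "norm (op_norm X (s n - a) - 0) < r" if "n \<ge> N" for n
    proof -
      have "op_norm X (s n - a) \<le> r / 2"
        by (rule op_norm_leI) (use a_L2_and_bound[OF N that] r in auto)
      then show ?thesis
        using op_norm_nonneg[of "s n - a" X] s a r by simp
    qed
    then show "\<exists>no. \<forall>n\<ge>no. norm (op_norm X (s n - a) - 0) < r" by blast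
  qed
  ultimately show ?thesis by blast
qed

section \<open>Consequences of convergence in operator norm\<close>

lemma op_limit_pointwise:
  assumes "\<And>n. s n \<in> bounded_ops X" "a \<in> bounded_ops X"
    and lim: "(\<lambda>n. op_norm X (s n - a)) \<longlonglongrightarrow> 0" and f: "f \<in> L2 X"
  shows "(\<lambda>n. L2_norm X (s n f - a f)) \<longlonglongrightarrow> 0"
proof (rule Lim_null_comparison)
  show "\<forall>\<^sub>F n in sequentially. norm (L2_norm X (s n f - a f)) \<le> op_norm X (s n - a) * L2_norm X f"
    using op_norm_bound[of "s _ - a" X f] assms by simp
  show "(\<lambda>n. op_norm X (s n - a) * L2_norm X f) \<longlonglongrightarrow> 0"
    using tendsto_mult_right[OF lim] by simp
qed

lemma op_limit_Cauchy:
  assumes s: "\<And>n. s n \<in> bounded_ops X" and a: "a \<in> bounded_ops X"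
    and lim: "(\<lambda>n. op_norm X (s n - a)) \<longlonglongrightarrow> 0" and "\<epsilon> > 0"
  shows "\<exists>N. \<forall>m\<ge>N. \<forall>n\<ge>N. op_norm X (s m - s n) \<le> \<epsilon>"
proof -
  obtain N where N: "\<forall>n\<ge>N. norm (op_norm X (s n - a) - 0) < \<epsilon> / 2"
    using LIMSEQ_D[OF lim, of "\<epsilon> / 2"] \<open>\<epsilon> > 0\<close> by auto
  have "op_norm X (s m - s n) \<le> \<epsilon>" if "m \<ge> N" "n \<ge> N" for m n
  proof -
    have "op_norm X (s m - a) < \<epsilon> / 2" "op_norm X (s n - a) < \<epsilon> / 2"
      using N that by fastforce+
    then show ?thesis
      using op_norm_triangle_minus[OF s a s, of m n] by (simp add: op_norm_minus_commute[of X a])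
  qed
  then show ?thesis by blast
qed

lemma L2_inner_limit_right:
  assumes f: "f \<in> L2 X" and g: "\<And>n. g n \<in> L2 X" "h \<in> L2 X"
    and lim: "(\<lambda>n. L2_norm X (g n - h)) \<longlonglongrightarrow> 0"
  shows "(\<lambda>n. L2_inner X f (g n)) \<longlonglongrightarrow> L2_inner X f h"
proof -
  have "(\<lambda>n. L2_inner X f (g n) - L2_inner X f h) \<longlonglongrightarrow> 0"
  proof (rule Lim_null_comparison)
    show "\<forall>\<^sub>F n in sequentially. norm (L2_inner X f (g n) - L2_inner X f h)
        \<le> L2_norm X f * L2_norm X (g n - h)"
      using L2_inner_bound[OF f, of "g _ - h"] f g by (simp add: L2_inner_diff_right)
    show "(\<lambda>n. L2_norm X f * L2_norm X (g n - h)) \<longlonglongrightarrow> 0"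
      using tendsto_mult_left[OF lim] by simp
  qed
  then show ?thesis by (simp add: LIM_zero_iff)
qed

text \<open>\<open>op_norm\<close> separates points inside \<open>bounded_ops X\<close>, where the
  values off \<open>L2 X\<close> are fixed to be 0; uniqueness of limits is therefore stated for
  bounded operators.\<close>

lemma op_limit_eqI:
  assumes s: "\<And>n. s n \<in> bounded_ops X" and a: "a \<in> bounded_ops X" and b: "b \<in> bounded_ops X"
    and lim: "(\<lambda>n. op_norm X (s n - a)) \<longlonglongrightarrow> 0" "(\<lambda>n. op_norm X (s n - b)) \<longlonglongrightarrow> 0"
  shows "a = b"
proof -
  have "(\<lambda>n. op_norm X (s n - a) + op_norm X (s n - b)) \<longlonglongrightarrow> 0 + 0"
    using lim by (rule tendsto_add)
  moreover have "op_norm X (a - b) \<le> op_norm X (s n - a) + op_norm X (s n - b)" for n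
    using op_norm_triangle_minus[OF a s b, of n] by (simp add: op_norm_minus_commute[of X a])
  ultimately have "op_norm X (a - b) \<le> 0"
    by (intro tendsto_lowerbound[where F = sequentially]) auto
  have "(a - b) f = 0" if f: "f \<in> L2 X" for f
  proof (rule L2_norm_eq_0)
    have "L2_norm X ((a - b) f) \<le> op_norm X (a - b) * L2_norm X f"
      by (intro op_norm_bound f bounded_ops_minus a b)
    also have "\<dots> \<le> 0"
      using \<open>op_norm X (a - b) \<le> 0\<close> by (simp add: mult_nonpos_nonneg)
    finally show "L2_norm X ((a - b) f) = 0"
      using L2_norm_nonneg[of X "(a - b) f"] by linarith
  qed (intro bounded_ops_L2 bounded_ops_minus a b)
  then show ?thesis
    by (intro bounded_ops_ext[OF a b]) (simp add: fun_eq_iff)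
qed

section \<open>Adjoints\<close>

lemma is_adjointD:
  assumes "is_adjoint X a b"
  shows "a \<in> bounded_ops X" "b \<in> bounded_ops X"
    and "f \<in> L2 X \<Longrightarrow> g \<in> L2 X \<Longrightarrow> L2_inner X (b f) g = L2_inner X f (a g)"
  using assms by (auto simp: is_adjoint_def)

lemma is_adjoint_sym: "is_adjoint X a b \<Longrightarrow> is_adjoint X b a"
  unfolding is_adjoint_def by (metis L2_inner_commute)

lemma is_adjoint_add:
  assumes "is_adjoint X a b" "is_adjoint X c d"
  shows "is_adjoint X (a + c) (b + d)"
proof -
  note [simp] = is_adjointD(1,2)[OF assms(1)] is_adjointD(1,2)[OF assms(2)]
  show ?thesis
    unfolding is_adjoint_def
    by (simp add: L2_inner_add_left L2_inner_add_right is_adjointD(3)[OF assms(1)]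
        is_adjointD(3)[OF assms(2)])
qed

lemma is_adjoint_scale:
  assumes "is_adjoint X a b"
  shows "is_adjoint X (op_scale c a) (op_scale (cnj c) b)"
  using assms unfolding is_adjoint_def
  by (simp add: op_scale_def[of _ b] op_scale_def[of _ a] L2_inner_scale_left L2_inner_scale_right
      bounded_ops_op_scale[unfolded op_scale_def])

lemma is_adjoint_diff:
  assumes "is_adjoint X a b" "is_adjoint X c d"
  shows "is_adjoint X (a - c) (b - d)"
  using is_adjoint_add[OF assms(1) is_adjoint_scale[OF assms(2), of "- 1"]]
  by (simp add: op_minus_eq_add_scale)

lemma is_adjoint_comp:
  assumes "is_adjoint X a b" "is_adjoint X c d"
  shows "is_adjoint X (a \<circ> c) (d \<circ> b)"
proof -
  note [simp] = is_adjointD(1,2)[OF assms(1)] is_adjointD(1,2)[OF assms(2)]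
  show ?thesis
    unfolding is_adjoint_def
    by (simp add: is_adjointD(3)[OF assms(1)] is_adjointD(3)[OF assms(2)])
qed

lemma is_adjoint_id: "is_adjoint X (id_op X) (id_op X)"
  by (simp add: is_adjoint_def) (simp add: id_op_def)

lemma is_adjoint_zero: "is_adjoint X 0 0"
  using is_adjoint_diff[OF is_adjoint_id is_adjoint_id, of X] by simp

text \<open>Both candidates are tested against \<open>b f - c f\<close> itself. This links the
  existence of one adjoint in a set to the closure clause of \<open>cstar_subalgebra\<close>, which
  speaks of every adjoint.\<close>

lemma is_adjoint_unique:
  assumes "is_adjoint X a b" "is_adjoint X a c"
  shows "b = c"
proof (rule bounded_ops_ext)
  show b: "b \<in> bounded_ops X" and c: "c \<in> bounded_ops X"
    using assms by (auto dest: is_adjointD)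
  fix f assume f: "f \<in> L2 X"
  have "L2_inner X (b f - c f) (b f - c f) = 0"
    using is_adjointD(3)[OF assms(1) f, of "b f - c f"] is_adjointD(3)[OF assms(2) f, of "b f - c f"] b c
    by (simp add: L2_inner_diff_left)
  then have "b f - c f = 0"
    using b c by (intro L2_norm_eq_0[of _ X]) (simp_all add: L2_inner_self)
  then show "b f = c f" by simp
qed

text \<open>The square of the norm of \<open>b f\<close> is the inner product of \<open>f\<close>
  with \<open>a (b f)\<close>; Cauchy-Schwarz leaves one factor to cancel.\<close>

lemma op_norm_adjoint_le:
  assumes "is_adjoint X a b"
  shows "op_norm X b \<le> op_norm X a"
proof (rule op_norm_leI)
  note ab [simp] = is_adjointD(1,2)[OF assms]
  show "0 \<le> op_norm X a" by (simp add: op_norm_nonneg)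
  fix f assume f: "f \<in> L2 X"
  let ?t = "L2_norm X (b f)"
  have "?t\<^sup>2 = cmod (L2_inner X (b f) (b f))"
    by (simp add: L2_inner_self norm_power)
  also have "\<dots> = cmod (L2_inner X f (a (b f)))"
    using is_adjointD(3)[OF assms f, of "b f"] by simp
  also have "\<dots> \<le> L2_norm X f * L2_norm X (a (b f))"
    by (intro L2_inner_bound f) simp
  also have "\<dots> \<le> L2_norm X f * (op_norm X a * ?t)"
    by (intro mult_left_mono op_norm_bound) auto
  finally have "?t * ?t \<le> (op_norm X a * L2_norm X f) * ?t"
    by (simp add: power2_eq_square mult_ac)
  then show "?t \<le> op_norm X a * L2_norm X f"
    using op_norm_nonneg[OF ab(1)] L2_norm_nonneg[of X "b f"]
    by (cases "?t = 0") (auto simp: mult_le_cancel_right)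
qed

lemma op_norm_adjoint:
  "is_adjoint X a b \<Longrightarrow> op_norm X b = op_norm X a"
  using op_norm_adjoint_le is_adjoint_sym by (metis order_antisym)

lemma is_adjoint_limit:
  assumes adj: "\<And>n. is_adjoint X (s n) (t n)" and a: "a \<in> bounded_ops X" and b: "b \<in> bounded_ops X"
    and lim: "(\<lambda>n. op_norm X (s n - a)) \<longlonglongrightarrow> 0" "(\<lambda>n. op_norm X (t n - b)) \<longlonglongrightarrow> 0"
  shows "is_adjoint X a b"
  unfolding is_adjoint_def
proof (intro conjI ballI a b)
  fix f g assume f: "f \<in> L2 X" and g: "g \<in> L2 X"
  have s: "s n \<in> bounded_ops X" and t: "t n \<in> bounded_ops X" for n
    using adj[of n] by (auto dest: is_adjointD)
  have "(\<lambda>n. L2_inner X f (s n g)) \<longlonglongrightarrow> L2_inner X f (a g)"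
    by (intro L2_inner_limit_right f op_limit_pointwise s a lim g bounded_ops_L2)
  \<comment> \<open>Continuity of the inner product is at hand in the second argument, hence the
    conjugation.\<close>
  moreover have "(\<lambda>n. cnj (L2_inner X g (t n f))) \<longlonglongrightarrow> cnj (L2_inner X g (b f))"
    by (intro tendsto_cnj L2_inner_limit_right g op_limit_pointwise t b lim f bounded_ops_L2)
  moreover have "cnj (L2_inner X g (t n f)) = L2_inner X f (s n g)" for n
    using is_adjointD(3)[OF adj f g] by (simp flip: L2_inner_commute)
  ultimately have "L2_inner X f (a g) = cnj (L2_inner X g (b f))"
    using LIMSEQ_unique by auto
  then show "L2_inner X (b f) g = L2_inner X f (a g)"
    by (simp flip: L2_inner_commute)
qed

section \<open>Generated C*-algebras\<close>

text \<open>This is \<open>cstar_subalgebra\<close> without product and adjoint. The sets on which a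
  limit relation holds are closed under these operations but not under products, so density
  arguments are run on this weaker structure.\<close>

definition closed_subspace :: "'g set \<Rightarrow> 'g op set \<Rightarrow> bool" where
  "closed_subspace X V \<longleftrightarrow>
     V \<subseteq> bounded_ops X \<and>
     0 \<in> V \<and>
     (\<forall>a\<in>V. \<forall>b\<in>V. a + b \<in> V) \<and>
     (\<forall>c. \<forall>a\<in>V. op_scale c a \<in> V) \<and>
     (\<forall>s a. (\<forall>n. s n \<in> V) \<and> a \<in> bounded_ops X \<and>
            (\<lambda>n::nat. op_norm X (s n - a)) \<longlonglongrightarrow> 0 \<longrightarrow> a \<in> V)"

lemma closed_subspaceI:
  assumes "V \<subseteq> bounded_ops X" "0 \<in> V"
    and "\<And>a b. a \<in> V \<Longrightarrow> b \<in> V \<Longrightarrow> a + b \<in> V"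
    and "\<And>c a. a \<in> V \<Longrightarrow> op_scale c a \<in> V"
    and "\<And>s a. (\<And>n::nat. s n \<in> V) \<Longrightarrow> a \<in> bounded_ops X \<Longrightarrow>
           (\<lambda>n. op_norm X (s n - a)) \<longlonglongrightarrow> 0 \<Longrightarrow> a \<in> V"
  shows "closed_subspace X V"
  using assms unfolding closed_subspace_def by blast

lemma closed_subspaceD:
  assumes "closed_subspace X V"
  shows "a \<in> V \<Longrightarrow> a \<in> bounded_ops X" and "0 \<in> V"
    and "a \<in> V \<Longrightarrow> b \<in> V \<Longrightarrow> a + b \<in> V"
    and "a \<in> V \<Longrightarrow> op_scale c a \<in> V"
    and "(\<And>n::nat. s n \<in> V) \<Longrightarrow> a \<in> bounded_ops X \<Longrightarrow>
           (\<lambda>n. op_norm X (s n - a)) \<longlonglongrightarrow> 0 \<Longrightarrow> a \<in> V"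
proof -
  note * = assms[unfolded closed_subspace_def]
  show "a \<in> V \<Longrightarrow> a \<in> bounded_ops X"
    using *[THEN conjunct1] by blast
  show "0 \<in> V"
    using *[THEN conjunct2, THEN conjunct1] .
  show "a \<in> V \<Longrightarrow> b \<in> V \<Longrightarrow> a + b \<in> V"
    using *[THEN conjunct2, THEN conjunct2, THEN conjunct1] by blast
  show "a \<in> V \<Longrightarrow> op_scale c a \<in> V"
    using *[THEN conjunct2, THEN conjunct2, THEN conjunct2, THEN conjunct1] by blast
  show "a \<in> V" if "\<And>n. s n \<in> V" "a \<in> bounded_ops X" "(\<lambda>n. op_norm X (s n - a)) \<longlonglongrightarrow> 0"
    by (rule *[THEN conjunct2, THEN conjunct2, THEN conjunct2, THEN conjunct2,
          THEN spec[of _ s], THEN spec[of _ a], THEN mp]) (intro conjI allI that)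
qed

lemma closed_subspace_diff:
  "closed_subspace X V \<Longrightarrow> a \<in> V \<Longrightarrow> b \<in> V \<Longrightarrow> a - b \<in> V"
  by (simp add: op_minus_eq_add_scale closed_subspaceD(3,4))

lemma closed_subspace_bounded_ops: "closed_subspace X (bounded_ops X)"
  by (rule closed_subspaceI) auto

lemma closed_subspace_Inter:
  assumes "\<And>V. V \<in> F \<Longrightarrow> closed_subspace X V" "F \<noteq> {}"
  shows "closed_subspace X (\<Inter>F)"
proof (rule closed_subspaceI)
  show "\<Inter>F \<subseteq> bounded_ops X"
    using assms closed_subspaceD(1) by fast
  show "0 \<in> \<Inter>F"
    using closed_subspaceD(2)[OF assms(1)] by blast
  show "a + b \<in> \<Inter>F" if "a \<in> \<Inter>F" "b \<in> \<Inter>F" for a b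
    using closed_subspaceD(3)[OF assms(1)] that by blast
  show "op_scale c a \<in> \<Inter>F" if "a \<in> \<Inter>F" for c a
    using closed_subspaceD(4)[OF assms(1)] that by blast
  show "a \<in> \<Inter>F" if "\<And>n. s n \<in> \<Inter>F" "a \<in> bounded_ops X" "(\<lambda>n. op_norm X (s n - a)) \<longlonglongrightarrow> 0"
    for s :: "nat \<Rightarrow> _" and a
    using closed_subspaceD(5)[OF assms(1) _ that(2,3)] that(1) by blast
qed

lemma closed_subspace_hull:
  assumes "M \<subseteq> bounded_ops X"
  shows "closed_subspace X (closed_subspace X hull M)"
  unfolding hull_def
  by (rule closed_subspace_Inter) (use assms closed_subspace_bounded_ops in auto)

lemma cstar_subalgebraD:
  assumes "cstar_subalgebra X A"
  shows "closed_subspace X A"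
    and "a \<in> A \<Longrightarrow> b \<in> A \<Longrightarrow> a \<circ> b \<in> A"
    and "a \<in> A \<Longrightarrow> is_adjoint X a b \<Longrightarrow> b \<in> A"
  using assms unfolding cstar_subalgebra_def closed_subspace_def by blast+

lemma cstar_subalgebraI:
  assumes "closed_subspace X A"
    and "\<And>a b. a \<in> A \<Longrightarrow> b \<in> A \<Longrightarrow> a \<circ> b \<in> A"
    and "\<And>a b. a \<in> A \<Longrightarrow> is_adjoint X a b \<Longrightarrow> b \<in> A"
  shows "cstar_subalgebra X A"
  using assms unfolding cstar_subalgebra_def closed_subspace_def by blast

lemma cstar_subalgebra_bounded_ops: "cstar_subalgebra X (bounded_ops X)"
  by (rule cstar_subalgebraI[OF closed_subspace_bounded_ops]) (auto dest: is_adjointD)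

lemma cstar_subalgebra_generated:
  assumes "M \<subseteq> bounded_ops X"
  shows "cstar_subalgebra X (generated_cstar X M)"
  unfolding generated_cstar_def hull_def
proof (rule cstar_subalgebraI)
  show "closed_subspace X (\<Inter>{A. cstar_subalgebra X A \<and> M \<subseteq> A})"
    by (rule closed_subspace_Inter)
      (use assms cstar_subalgebra_bounded_ops cstar_subalgebraD(1) in auto)
qed (use cstar_subalgebraD(2,3)[of X] in blast)+

lemma op_limit_comp_right:
  assumes "\<And>n. s n \<in> bounded_ops X" "a \<in> bounded_ops X" "b \<in> bounded_ops X"
    and lim: "(\<lambda>n. op_norm X (s n - a)) \<longlonglongrightarrow> 0"
  shows "(\<lambda>n. op_norm X ((s n \<circ> b) - (a \<circ> b))) \<longlonglongrightarrow> 0"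
proof (rule Lim_null_comparison)
  show "\<forall>\<^sub>F n in sequentially. norm (op_norm X ((s n \<circ> b) - (a \<circ> b))) \<le> op_norm X (s n - a) * op_norm X b"
    using op_norm_comp[of "s _ - a" X b] assms op_norm_nonneg[of "(s _ - a) \<circ> b" X]
    by (simp flip: comp_diff_left)
  show "(\<lambda>n. op_norm X (s n - a) * op_norm X b) \<longlonglongrightarrow> 0"
    using tendsto_mult_right[OF lim] by simp
qed

lemma op_limit_comp_left:
  assumes "\<And>n. s n \<in> bounded_ops X" "a \<in> bounded_ops X" "b \<in> bounded_ops X"
    and lim: "(\<lambda>n. op_norm X (s n - a)) \<longlonglongrightarrow> 0"
  shows "(\<lambda>n. op_norm X ((b \<circ> s n) - (b \<circ> a))) \<longlonglongrightarrow> 0"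
proof (rule Lim_null_comparison)
  show "\<forall>\<^sub>F n in sequentially. norm (op_norm X ((b \<circ> s n) - (b \<circ> a))) \<le> op_norm X b * op_norm X (s n - a)"
    using op_norm_comp[of b X "s _ - a"] assms op_norm_nonneg[of "b \<circ> (s _ - a)" X]
    by (simp flip: comp_diff_right[of _ X])
  show "(\<lambda>n. op_norm X b * op_norm X (s n - a)) \<longlonglongrightarrow> 0"
    using tendsto_mult_left[OF lim] by simp
qed

text \<open>Multiplication by a fixed operator is linear and norm continuous, so closed subspaces
  pull back along it. Used to extend closure under products one factor at a time.\<close>

lemma closed_subspace_vimage_comp:
  assumes V: "closed_subspace X V" and b: "b \<in> bounded_ops X"
  shows "closed_subspace X {a \<in> bounded_ops X. a \<circ> b \<in> V}"
    and "closed_subspace X {a \<in> bounded_ops X. b \<circ> a \<in> V}"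
proof -
  show "closed_subspace X {a \<in> bounded_ops X. a \<circ> b \<in> V}"
  proof (rule closed_subspaceI)
    fix s :: "nat \<Rightarrow> _" and a assume s: "\<And>n. s n \<in> {a \<in> bounded_ops X. a \<circ> b \<in> V}"
      and a: "a \<in> bounded_ops X" and lim: "(\<lambda>n. op_norm X (s n - a)) \<longlonglongrightarrow> 0"
    have "(\<lambda>n. op_norm X ((s n \<circ> b) - (a \<circ> b))) \<longlonglongrightarrow> 0"
      using op_limit_comp_right[OF _ a b lim] s by blast
    then have "a \<circ> b \<in> V"
      using closed_subspaceD(5)[OF V, of "\<lambda>n. s n \<circ> b"] s bounded_ops_comp[OF a b] by blast
    with a show "a \<in> {a \<in> bounded_ops X. a \<circ> b \<in> V}" by simp
  next
    have "(0 :: 'a op) \<circ> b = 0" by (simp add: fun_eq_iff)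
    then show "0 \<in> {a \<in> bounded_ops X. a \<circ> b \<in> V}"
      using closed_subspaceD(2)[OF V] by simp
  qed (auto simp: comp_add_left comp_scale_left closed_subspaceD(3,4)[OF V])
  show "closed_subspace X {a \<in> bounded_ops X. b \<circ> a \<in> V}"
  proof (rule closed_subspaceI)
    fix s :: "nat \<Rightarrow> _" and a assume s: "\<And>n. s n \<in> {a \<in> bounded_ops X. b \<circ> a \<in> V}"
      and a: "a \<in> bounded_ops X" and lim: "(\<lambda>n. op_norm X (s n - a)) \<longlonglongrightarrow> 0"
    have "(\<lambda>n. op_norm X ((b \<circ> s n) - (b \<circ> a))) \<longlonglongrightarrow> 0"
      using op_limit_comp_left[OF _ a b lim] s by blast
    then have "b \<circ> a \<in> V"
      using closed_subspaceD(5)[OF V, of "\<lambda>n. b \<circ> s n"] s bounded_ops_comp[OF b a] by blast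
    with a show "a \<in> {a \<in> bounded_ops X. b \<circ> a \<in> V}" by simp
  next
    have "b \<circ> (0 :: 'a op) = 0" using bounded_ops_0[OF b] by (simp add: fun_eq_iff)
    then show "0 \<in> {a \<in> bounded_ops X. b \<circ> a \<in> V}"
      using closed_subspaceD(2)[OF V] by simp
  qed (auto simp: comp_add_right[OF _ _ b] comp_scale_right[OF _ b] closed_subspaceD(3,4)[OF V] b)
qed

text \<open>Taking adjoints is isometric, so the adjoints of a convergent sequence form a Cauchy
  sequence; completeness supplies their limit, which is the adjoint of the limit.\<close>

lemma closed_subspace_adjoints:
  assumes V: "closed_subspace X V"
  shows "closed_subspace X {a. \<exists>b\<in>V. is_adjoint X a b}"
proof (rule closed_subspaceI)
  fix s :: "nat \<Rightarrow> _" and a assume s: "\<And>n. s n \<in> {a. \<exists>b\<in>V. is_adjoint X a b}"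
    and a: "a \<in> bounded_ops X" and lim: "(\<lambda>n. op_norm X (s n - a)) \<longlonglongrightarrow> 0"
  obtain t where t: "\<And>n. t n \<in> V" "\<And>n. is_adjoint X (s n) (t n)"
    using s by simp metis
  have bd: "s n \<in> bounded_ops X" "t n \<in> bounded_ops X" for n
    using is_adjointD[OF t(2)] by auto
  have "op_norm X (t m - t n) = op_norm X (s m - s n)" for m n
    by (intro op_norm_adjoint is_adjoint_diff t)
  then obtain b where b: "b \<in> bounded_ops X" "(\<lambda>n. op_norm X (t n - b)) \<longlonglongrightarrow> 0"
    using bounded_ops_complete[of t X] op_limit_Cauchy[OF bd(1) a lim] bd by auto
  then have "b \<in> V"
    using closed_subspaceD(5)[OF V, of t b] t(1) by simp
  moreover have "is_adjoint X a b"
    using is_adjoint_limit[OF t(2) a b(1) lim b(2)] .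
  ultimately show "a \<in> {a. \<exists>b\<in>V. is_adjoint X a b}" by blast
next
  show "{a. \<exists>b\<in>V. is_adjoint X a b} \<subseteq> bounded_ops X"
    using is_adjointD(1) by blast
  show "0 \<in> {a. \<exists>b\<in>V. is_adjoint X a b}"
    using closed_subspaceD(2)[OF V] is_adjoint_zero by blast
  show "a + a' \<in> {a. \<exists>b\<in>V. is_adjoint X a b}"
    if "a \<in> {a. \<exists>b\<in>V. is_adjoint X a b}" "a' \<in> {a. \<exists>b\<in>V. is_adjoint X a b}" for a a'
    using that closed_subspaceD(3)[OF V] is_adjoint_add by blast
  show "op_scale c a \<in> {a. \<exists>b\<in>V. is_adjoint X a b}"
    if "a \<in> {a. \<exists>b\<in>V. is_adjoint X a b}" for c a
    using that closed_subspaceD(4)[OF V] is_adjoint_scale by blast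
qed

lemma generated_cstar_subset:
  assumes "cstar_subalgebra X A" "M \<subseteq> A"
  shows "generated_cstar X M \<subseteq> A"
  unfolding generated_cstar_def by (rule hull_minimal[where S = "cstar_subalgebra X", OF assms(2,1)])

lemma generated_cstar_inc: "M \<subseteq> generated_cstar X M"
  unfolding generated_cstar_def by (rule hull_subset)

text \<open>For generators closed under product and adjoint, linear combinations already form a star
  algebra, and only the norm closure remains to be taken.\<close>

locale star_semigroup =
  fixes X :: "'g set" and M :: "'g op set"
  assumes mult_closed: "a \<in> M \<Longrightarrow> b \<in> M \<Longrightarrow> a \<circ> b \<in> M"
    and adjoint_closed: "a \<in> M \<Longrightarrow> \<exists>b\<in>M. is_adjoint X a b"
begin

abbreviation span ("W") where "W \<equiv> closed_subspace X hull M"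

lemma M_bounded: "M \<subseteq> bounded_ops X"
  using adjoint_closed by (auto dest: is_adjointD)

lemma M_subset: "M \<subseteq> W" by (rule hull_subset)

lemma closed_W: "closed_subspace X W"
  by (rule closed_subspace_hull[OF M_bounded])

text \<open>One factor at a time: with a generator fixed on the right, the left factor runs through
  the span; then the left factor is fixed and the right one runs.\<close>

lemma W_comp:
  assumes "a \<in> W" "b \<in> W"
  shows "a \<circ> b \<in> W"
proof -
  have *: "a \<circ> m \<in> W" if m: "m \<in> M" and a: "a \<in> W" for m a
  proof -
    have "W \<subseteq> {a \<in> bounded_ops X. a \<circ> m \<in> W}"
      by (rule hull_minimal[where S = "closed_subspace X", OF _ closed_subspace_vimage_comp(1)[OF closed_W]])
        (use M_bounded m mult_closed M_subset in auto)
    then show ?thesis using a by blast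
  qed
  have "W \<subseteq> {b \<in> bounded_ops X. a \<circ> b \<in> W}"
    by (rule hull_minimal[where S = "closed_subspace X", OF _ closed_subspace_vimage_comp(2)[OF closed_W]])
      (use M_bounded * assms closed_subspaceD(1)[OF closed_W] in auto)
  then show ?thesis using assms by blast
qed

lemma W_adjoint:
  assumes "a \<in> W"
  shows "\<exists>b\<in>W. is_adjoint X a b"
proof -
  have "W \<subseteq> {a. \<exists>b\<in>W. is_adjoint X a b}"
    by (rule hull_minimal[where S = "closed_subspace X", OF _ closed_subspace_adjoints[OF closed_W]])
      (use adjoint_closed M_subset in blast)
  then show ?thesis using assms by blast
qed

lemma generated_eq_W: "generated_cstar X M = W"
proof
  have "cstar_subalgebra X W"
    using closed_W W_comp W_adjoint is_adjoint_unique by (metis cstar_subalgebraI)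
  then show "generated_cstar X M \<subseteq> W"
    by (rule generated_cstar_subset[OF _ M_subset])
  show "W \<subseteq> generated_cstar X M"
    by (rule hull_minimal[where S = "closed_subspace X", OF generated_cstar_inc
          cstar_subalgebraD(1)[OF cstar_subalgebra_generated[OF M_bounded]]])
qed

text \<open>The induction principle for the generated algebra: a linear, norm-closed property has to
  be checked on \<open>M\<close> alone, with no step for products or adjoints.\<close>

lemma generated_cstar_subset_closed_subspace:
  assumes "closed_subspace X V" "M \<subseteq> V"
  shows "generated_cstar X M \<subseteq> V"
  unfolding generated_eq_W by (rule hull_minimal[where S = "closed_subspace X", OF assms(2,1)])

lemma generated_cstar_adjoint:
  assumes "a \<in> generated_cstar X M"
  shows "\<exists>b\<in>generated_cstar X M. is_adjoint X a b"
  using W_adjoint assms unfolding generated_eq_W .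

end

section \<open>Automatic contractivity\<close>

text \<open>From u u - v v = u (u - v) + (u - v) v, an identity valid without commutativity.\<close>

lemma half_add_square_lipschitz:
  assumes x: "x \<in> bounded_ops X" and u: "u \<in> bounded_ops X" and v: "v \<in> bounded_ops X"
  shows "op_norm X (op_scale (1 / 2) (x + (u \<circ> u)) - op_scale (1 / 2) (x + (v \<circ> v)))
    \<le> (op_norm X u + op_norm X v) / 2 * op_norm X (u - v)"
proof -
  note [simp] = x u v
  have "op_scale (1 / 2) (x + (u \<circ> u)) - op_scale (1 / 2) (x + (v \<circ> v))
      = op_scale (1 / 2) ((u \<circ> (u - v)) + ((u - v) \<circ> v))"
    unfolding comp_diff_right[OF u v u]
    by (simp add: fun_eq_iff op_scale_def vec_scale_def algebra_simps)
  then have "op_norm X (op_scale (1 / 2) (x + (u \<circ> u)) - op_scale (1 / 2) (x + (v \<circ> v)))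
      \<le> cmod (1 / 2) * op_norm X ((u \<circ> (u - v)) + ((u - v) \<circ> v))"
    using op_norm_scale_le[of "(u \<circ> (u - v)) + ((u - v) \<circ> v)" X "1 / 2"] by simp
  also have "op_norm X ((u \<circ> (u - v)) + ((u - v) \<circ> v))
      \<le> op_norm X (u \<circ> (u - v)) + op_norm X ((u - v) \<circ> v)"
    by (intro op_norm_triangle) simp_all
  also have "\<dots> \<le> op_norm X u * op_norm X (u - v) + op_norm X (u - v) * op_norm X v"
    by (intro add_mono op_norm_comp) simp_all
  finally show ?thesis by (simp add: algebra_simps)
qed

text \<open>The square root is \<open>1 - z\<close> with \<open>z\<close> the fixed point of \<open>y \<mapsto> (x + y\<^sup>2) / 2\<close>, a contraction on the
  ball of radius \<open>1 - sqrt (1 - q)\<close>.\<close>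

lemma sqrt_id_minus:
  assumes A: "cstar_subalgebra X A" and id: "id_op X \<in> A"
    and x: "x \<in> A" "is_adjoint X x x" "op_norm X x \<le> q" and q: "q < 1"
  shows "\<exists>b\<in>A. is_adjoint X b b \<and> b \<circ> b = id_op X - x"
proof -
  note cl = cstar_subalgebraD(1)[OF A]
  note bd = closed_subspaceD(1)[OF cl]
  define r where "r = 1 - sqrt (1 - q)"
  have q0: "q \<ge> 0"
    using x(3) op_norm_nonneg[OF bd[OF x(1)]] by linarith
  \<comment> \<open>\<open>r\<close> is the smaller root of \<open>r * r - 2 * r + q = 0\<close>, a
    fixed point of the scalar iteration. It bounds the norm of every iterate and is also the
    Lipschitz constant, smaller than 1 because \<open>q < 1\<close>.\<close>
  have r: "0 \<le> r" "r < 1" "(q + r * r) / 2 = r"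
  proof -
    show "0 \<le> r" "r < 1" using q q0 by (simp_all add: r_def)
    have "sqrt (1 - q) * sqrt (1 - q) = 1 - q" using q by simp
    then have "q + r * r = 2 * r" unfolding r_def by (simp add: algebra_simps)
    then show "(q + r * r) / 2 = r" by simp
  qed
  define y where "y = rec_nat 0 (\<lambda>_ y. op_scale (1 / 2) (x + (y \<circ> y)))"
  have y_0: "y 0 = 0" and y_Suc: "y (Suc n) = op_scale (1 / 2) (x + (y n \<circ> y n))" for n
    by (simp_all add: y_def)
  have yA: "y n \<in> A" for n
  proof (induction n)
    case 0
    show ?case unfolding y_0 by (rule closed_subspaceD(2)[OF cl])
  next
    case (Suc n)
    then show ?case
      unfolding y_Suc by (intro closed_subspaceD(3,4)[OF cl] cstar_subalgebraD(2)[OF A] x)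
  qed
  note yb = bd[OF yA]
  have adj: "is_adjoint X (y n) (y n)" for n
  proof (induction n)
    case (Suc n)
    then show ?case
      unfolding y_Suc
      using is_adjoint_scale[OF is_adjoint_add[OF x(2) is_adjoint_comp], of "y n" "y n" "y n" "y n" "1 / 2"]
      by simp
  qed (unfold y_0, rule is_adjoint_zero)
  have norm_y: "op_norm X (y n) \<le> r" for n
  proof (induction n)
    case (Suc n)
    have "op_norm X (y (Suc n)) \<le> cmod (1 / 2) * op_norm X (x + (y n \<circ> y n))"
      unfolding y_Suc by (intro op_norm_scale_le bounded_ops_plus bounded_ops_comp yb bd x)
    also have "op_norm X (x + (y n \<circ> y n)) \<le> op_norm X x + op_norm X (y n \<circ> y n)"
      by (intro op_norm_triangle bounded_ops_comp yb bd x)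
    also have "op_norm X (y n \<circ> y n) \<le> op_norm X (y n) * op_norm X (y n)"
      by (intro op_norm_comp yb)
    also have "\<dots> \<le> r * r"
      by (intro mult_mono Suc op_norm_nonneg yb r)
    finally show ?case using x(3) r(3) by simp
  qed (unfold y_0, simp only: op_norm_zero r(1))
  have step: "op_norm X (y (Suc m) - y (Suc n)) \<le> r * op_norm X (y m - y n)" for m n
  proof -
    have "op_norm X (y (Suc m) - y (Suc n)) \<le> (op_norm X (y m) + op_norm X (y n)) / 2 * op_norm X (y m - y n)"
      unfolding y_Suc by (intro half_add_square_lipschitz yb bd x)
    also have "\<dots> \<le> r * op_norm X (y m - y n)"
      using norm_y[of m] norm_y[of n]
      by (intro mult_right_mono op_norm_nonneg bounded_ops_minus yb) simp
    finally show ?thesis .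
  qed
  \<comment> \<open>Both indices are shifted together, so one use of \<open>step\<close> gains a
    factor \<open>r\<close>. The initial 2 bounds the distance of two iterates of norm at most
    \<open>r < 1\<close>.\<close>
  have geometric: "\<forall>m\<ge>k. \<forall>n\<ge>k. op_norm X (y m - y n) \<le> 2 * r ^ k" for k
  proof (induction k)
    case 0
    have "op_norm X (y m - y n) \<le> 2" for m n
    proof -
      have "op_norm X (y m - y n) \<le> op_norm X (y m - 0) + op_norm X (0 - y n)"
        by (intro op_norm_triangle_minus yb bounded_ops_zero)
      then show ?thesis
        using norm_y[of m] norm_y[of n] r(2) op_norm_minus_commute[of X "y n" 0] by simp
    qed
    then show ?case by (simp only: power_0 mult_1_right) blast
  next
    case (Suc k)
    show ?case
    proof (intro allI impI)
      fix m n assume "m \<ge> Suc k" "n \<ge> Suc k"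
      then obtain m' n' where mn: "m = Suc m'" "n = Suc n'" "m' \<ge> k" "n' \<ge> k"
        by (metis Suc_le_D Suc_le_mono)
      have "r * op_norm X (y m' - y n') \<le> r * (2 * r ^ k)"
        by (intro mult_left_mono Suc[rule_format] mn r)
      then show "op_norm X (y m - y n) \<le> 2 * r ^ Suc k"
        using step[of m' n'] mn by simp
    qed
  qed
  have "\<exists>N. \<forall>m\<ge>N. \<forall>n\<ge>N. op_norm X (y m - y n) \<le> \<epsilon>" if "\<epsilon> > 0" for \<epsilon>
  proof -
    obtain k where "r ^ k < \<epsilon> / 2"
      using real_arch_pow_inv[of "\<epsilon> / 2" r] r \<open>\<epsilon> > 0\<close> by auto
    then have "2 * r ^ k \<le> \<epsilon>" by simp
    then show ?thesis using geometric[of k] order_trans by blast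
  qed
  then obtain z where z: "z \<in> bounded_ops X" and lim: "(\<lambda>n. op_norm X (y n - z)) \<longlonglongrightarrow> 0"
    using bounded_ops_complete[of y X] yb by blast
  have zA: "z \<in> A"
    using closed_subspaceD(5)[OF cl, of y z] yA z lim by simp
  have adj_z: "is_adjoint X z z"
    by (rule is_adjoint_limit[OF adj z z lim lim])
  \<comment> \<open>Both sides are limits of the shifted sequence, the right one by the Lipschitz
    estimate.\<close>
  have fix_z: "z = op_scale (1 / 2) (x + (z \<circ> z))" (is "_ = ?w")
  proof (rule op_limit_eqI[of "\<lambda>n. y (Suc n)" X])
    show "y (Suc n) \<in> bounded_ops X" for n by (rule yb)
    show "z \<in> bounded_ops X" by (rule z)
    show "?w \<in> bounded_ops X"
      by (intro bounded_ops_op_scale bounded_ops_plus bounded_ops_comp z bd x)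
    show "(\<lambda>n. op_norm X (y (Suc n) - z)) \<longlonglongrightarrow> 0"
      using LIMSEQ_Suc[OF lim] .
    show "(\<lambda>n. op_norm X (y (Suc n) - ?w)) \<longlonglongrightarrow> 0"
    proof (rule Lim_null_comparison)
      let ?C = "(r + op_norm X z) / 2"
      have "norm (op_norm X (y (Suc n) - ?w)) \<le> ?C * op_norm X (y n - z)" for n
      proof -
        have "op_norm X (y (Suc n) - ?w) \<le> (op_norm X (y n) + op_norm X z) / 2 * op_norm X (y n - z)"
          unfolding y_Suc by (intro half_add_square_lipschitz yb bd x z)
        also have "\<dots> \<le> ?C * op_norm X (y n - z)"
          using norm_y[of n] by (intro mult_right_mono op_norm_nonneg bounded_ops_minus yb z) simp
        finally show ?thesis
          using op_norm_nonneg[of "y (Suc n) - ?w" X] \<open>?w \<in> bounded_ops X\<close> yb by simp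
      qed
      then show "\<forall>\<^sub>F n in sequentially. norm (op_norm X (y (Suc n) - ?w)) \<le> ?C * op_norm X (y n - z)"
        by simp
      show "(\<lambda>n. ?C * op_norm X (y n - z)) \<longlonglongrightarrow> 0"
        using tendsto_mult_left[OF lim] by simp
    qed
  qed
  \<comment> \<open>Since 2 z = x + z z, the square of 1 - z is 1 - 2 z + z z = 1 - x.\<close>
  define b where "b = id_op X - z"
  have "b \<in> A" unfolding b_def by (intro closed_subspace_diff[OF cl] id zA)
  moreover have "is_adjoint X b b"
    unfolding b_def by (intro is_adjoint_diff is_adjoint_id adj_z)
  moreover have "b \<circ> b = id_op X - x"
  proof (rule bounded_ops_ext)
    show "b \<circ> b \<in> bounded_ops X" using \<open>b \<in> A\<close> bd by simp
    show "id_op X - x \<in> bounded_ops X" using x bd by simp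
    fix f assume f: "f \<in> L2 X"
    have zf: "z f = vec_scale (1 / 2) (x f + z (z f))"
      using fun_cong[OF fix_z, of f] by (simp add: op_scale_def)
    have bb: "b (b f) = (f - z f) - (z f - z (z f))"
      using f z by (simp add: b_def id_op_def bounded_ops_diff[OF z])
    have "b (b f) h = f h - x f h" for h
      unfolding bb using fun_cong[OF zf, of h] by (simp add: vec_scale_def field_simps)
    then show "(b \<circ> b) f = (id_op X - x) f"
      using f by (simp add: id_op_def fun_eq_iff)
  qed
  ultimately show ?thesis by blast
qed

text \<open>The assumptions are algebraic and contain no norm bound for \<theta>.
  \<open>adjoint_ex\<close> is listed because \<open>cstar_subalgebra\<close> does not provide
  adjoints; it only keeps existing ones inside.\<close>

locale unital_star_endomorphism =
  fixes X :: "'g set" and A :: "'g op set" and \<theta> :: "'g op \<Rightarrow> 'g op"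
  assumes A: "cstar_subalgebra X A"
    and id_op_in: "id_op X \<in> A"
    and adjoint_ex: "a \<in> A \<Longrightarrow> \<exists>b. is_adjoint X a b"
    and closed: "a \<in> A \<Longrightarrow> \<theta> a \<in> A"
    and linear: "linear_map_on A \<theta>"
    and comp: "a \<in> A \<Longrightarrow> b \<in> A \<Longrightarrow> \<theta> (a \<circ> b) = \<theta> a \<circ> \<theta> b"
    and adjoint: "a \<in> A \<Longrightarrow> is_adjoint X a b \<Longrightarrow> is_adjoint X (\<theta> a) (\<theta> b)"
    and unital: "\<theta> (id_op X) = id_op X"
begin

lemma add: "a \<in> A \<Longrightarrow> b \<in> A \<Longrightarrow> \<theta> (a + b) = \<theta> a + \<theta> b"
  and scale: "a \<in> A \<Longrightarrow> \<theta> (op_scale c a) = op_scale c (\<theta> a)"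
  using linear by (auto simp: linear_map_on_def)

text \<open>Write 1 - a* a as the square of a self-adjoint \<open>b\<close> in \<open>A\<close>.
  Applying \<theta> and pairing with \<open>f\<close> shows that the squared norms of
  \<open>\<theta> a f\<close> and \<open>\<theta> b f\<close> add up to that of
  \<open>f\<close>.\<close>

lemma contractive_aux:
  assumes a: "a \<in> A" "op_norm X a < 1" and f: "f \<in> L2 X"
  shows "L2_norm X (\<theta> a f) \<le> L2_norm X f"
proof -
  note cl = cstar_subalgebraD(1)[OF A]
  note bd = closed_subspaceD(1)[OF cl]
  obtain a' where adj: "is_adjoint X a a'" using adjoint_ex[OF a(1)] by blast
  have a'A: "a' \<in> A" by (rule cstar_subalgebraD(3)[OF A a(1) adj])
  let ?x = "a' \<circ> a"
  have xA: "?x \<in> A" by (intro cstar_subalgebraD(2)[OF A] a a'A)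
  \<comment> \<open>As \<open>a\<close> and its adjoint have equal norm, this gives the bound
    \<open>q = (op_norm X a)\<^sup>2 < 1\<close> that \<open>sqrt_id_minus\<close> demands.\<close>
  have "op_norm X ?x \<le> op_norm X a' * op_norm X a"
    by (intro op_norm_comp bd a a'A)
  then have "op_norm X ?x \<le> (op_norm X a)\<^sup>2"
    by (simp add: op_norm_adjoint[OF adj] power2_eq_square)
  moreover have "(op_norm X a)\<^sup>2 < 1"
    using a op_norm_nonneg[OF bd[OF a(1)]] by (simp add: power_less_one_iff)
  moreover have "is_adjoint X ?x ?x"
    by (intro is_adjoint_comp is_adjoint_sym[OF adj] adj)
  ultimately obtain b where b: "b \<in> A" "is_adjoint X b b" "b \<circ> b = id_op X - ?x"
    using sqrt_id_minus[OF A id_op_in xA] by blast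
  have "\<theta> b \<circ> \<theta> b = \<theta> (id_op X + op_scale (- 1) ?x)"
    using b comp[OF b(1) b(1)] by (simp add: op_minus_eq_add_scale)
  also have "\<dots> = id_op X - (\<theta> a' \<circ> \<theta> a)"
    using xA id_op_in closed_subspaceD(4)[OF cl xA, of "- 1"] a(1) a'A
    by (simp add: add scale unital comp op_minus_eq_add_scale)
  finally have eq: "\<theta> b (\<theta> b f) = f - \<theta> a' (\<theta> a f)"
    using f by (auto simp: id_op_def dest: fun_cong[of _ _ f])
  note adj_a = is_adjoint_sym[OF adjoint[OF a(1) adj]]
  note adj_b = adjoint[OF b(1,2)]
  have L2: "\<theta> a f \<in> L2 X" "\<theta> a' (\<theta> a f) \<in> L2 X" "\<theta> b f \<in> L2 X"
    using bounded_ops_L2[OF bd[OF closed[OF a(1)]]] bounded_ops_L2[OF bd[OF closed[OF a'A]]]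
      bounded_ops_L2[OF bd[OF closed[OF b(1)]]] by auto
  have "L2_inner X (\<theta> b f) (\<theta> b f) = L2_inner X f (\<theta> b (\<theta> b f))"
    using is_adjointD(3)[OF adj_b f] L2 by blast
  also have "\<dots> = L2_inner X f f - L2_inner X f (\<theta> a' (\<theta> a f))"
    unfolding eq by (intro L2_inner_diff_right f L2)
  also have "L2_inner X f (\<theta> a' (\<theta> a f)) = L2_inner X (\<theta> a f) (\<theta> a f)"
    using is_adjointD(3)[OF adj_a f] L2 by simp
  finally have "complex_of_real ((L2_norm X (\<theta> b f))\<^sup>2)
      = complex_of_real ((L2_norm X f)\<^sup>2 - (L2_norm X (\<theta> a f))\<^sup>2)"
    using L2 f by (simp add: L2_inner_self)
  then have "(L2_norm X (\<theta> b f))\<^sup>2 = (L2_norm X f)\<^sup>2 - (L2_norm X (\<theta> a f))\<^sup>2"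
    by (simp only: of_real_eq_iff)
  then have "(L2_norm X (\<theta> a f))\<^sup>2 \<le> (L2_norm X f)\<^sup>2"
    using zero_le_power2[of "L2_norm X (\<theta> b f)"] by linarith
  then show ?thesis
    by (rule power2_le_imp_le) simp
qed

text \<open>Division by \<open>op_norm X a + e\<close> makes the norm strictly less than 1, also
  when \<open>op_norm X a = 0\<close>; then \<open>e\<close> tends to 0.\<close>

lemma contractive:
  assumes a: "a \<in> A"
  shows "op_norm X (\<theta> a) \<le> op_norm X a"
proof (rule field_le_epsilon)
  note cl = cstar_subalgebraD(1)[OF A]
  note bd = closed_subspaceD(1)[OF cl]
  fix e :: real assume e: "e > 0"
  define t where "t = op_norm X a + e"
  have nonneg: "op_norm X a \<ge> 0" by (rule op_norm_nonneg[OF bd[OF a]])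
  then have t: "t > 0" "op_norm X a < t" using e by (auto simp: t_def)
  have "op_norm X (op_scale (complex_of_real (1 / t)) a) \<le> cmod (complex_of_real (1 / t)) * op_norm X a"
    by (rule op_norm_scale_le[OF bd[OF a]])
  also have "\<dots> = op_norm X a / t" using t by (simp add: norm_divide)
  also have "\<dots> < 1" using t by simp
  finally have less: "op_norm X (op_scale (complex_of_real (1 / t)) a) < 1" .
  show "op_norm X (\<theta> a) \<le> op_norm X a + e"
  proof (rule op_norm_leI)
    fix f assume f: "f \<in> L2 X"
    have "L2_norm X (\<theta> (op_scale (complex_of_real (1 / t)) a) f) \<le> L2_norm X f"
      by (rule contractive_aux[OF closed_subspaceD(4)[OF cl a] less f])
    moreover have "L2_norm X (\<theta> (op_scale (complex_of_real (1 / t)) a) f) = L2_norm X (\<theta> a f) / t"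
      using t by (simp add: scale[OF a] op_scale_def[of _ "\<theta> a"] norm_divide)
    ultimately show "L2_norm X (\<theta> a f) \<le> (op_norm X a + e) * L2_norm X f"
      using t by (simp add: divide_le_eq t_def mult.commute)
  qed (use nonneg e in simp)
qed

end

section \<open>The regular representation\<close>

context group
begin

lemma bij_betw_left_mult:
  assumes "g \<in> carrier G"
  shows "bij_betw (\<lambda>x. g \<otimes> x) (carrier G) (carrier G)"
  by (rule bij_betw_byWitness[where f' = "\<lambda>x. inv g \<otimes> x"]) (use assms in \<open>auto simp: m_assoc[symmetric]\<close>)

lemma reg_rep_apply:
  "f \<in> L2 (carrier G) \<Longrightarrow> reg_rep G g f = (\<lambda>h. if h \<in> carrier G then f (inv g \<otimes> h) else 0)"
  by (simp add: reg_rep_def)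

lemma
  assumes g: "g \<in> carrier G" and f: "f \<in> L2 (carrier G)"
  shows reg_rep_L2: "reg_rep G g f \<in> L2 (carrier G)"
    and L2_norm_reg_rep: "L2_norm (carrier G) (reg_rep G g f) = L2_norm (carrier G) f"
proof -
  note bij = bij_betw_left_mult[OF inv_closed[OF g]]
  have "(\<lambda>x. (cmod (f (inv g \<otimes> x)))\<^sup>2) summable_on carrier G"
    using summable_on_reindex_bij_betw[OF bij, of "\<lambda>x. (cmod (f x))\<^sup>2"] f by (simp add: L2_def)
  then have "(\<lambda>x. (cmod (reg_rep G g f x))\<^sup>2) summable_on carrier G"
    by (rule summable_on_cong[THEN iffD1, rotated]) (simp add: reg_rep_apply[OF f])
  then show "reg_rep G g f \<in> L2 (carrier G)"
    by (simp add: L2_def reg_rep_apply[OF f])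
  have "(\<Sum>\<^sub>\<infinity>x\<in>carrier G. (cmod (reg_rep G g f x))\<^sup>2) = (\<Sum>\<^sub>\<infinity>x\<in>carrier G. (cmod (f (inv g \<otimes> x)))\<^sup>2)"
    by (rule infsum_cong) (simp add: reg_rep_apply[OF f])
  also have "\<dots> = (\<Sum>\<^sub>\<infinity>x\<in>carrier G. (cmod (f x))\<^sup>2)"
    by (rule infsum_reindex_bij_betw[OF bij, of "\<lambda>x. (cmod (f x))\<^sup>2"])
  finally show "L2_norm (carrier G) (reg_rep G g f) = L2_norm (carrier G) f"
    by (simp add: L2_norm_def)
qed

lemma reg_rep_bounded:
  assumes g: "g \<in> carrier G"
  shows "reg_rep G g \<in> bounded_ops (carrier G)"
proof (rule bounded_opsI[where C = 1])
  show "reg_rep G g f = 0" if "f \<notin> L2 (carrier G)" for f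
    using that by (simp add: reg_rep_def)
qed (use g in \<open>simp_all add: reg_rep_L2 L2_norm_reg_rep, auto simp: reg_rep_apply vec_scale_def[of _ "_ :: 'a \<Rightarrow> _"] fun_eq_iff
      L2_scale[unfolded vec_scale_def]\<close>)

lemma reg_rep_mult:
  assumes g: "g \<in> carrier G" and h: "h \<in> carrier G"
  shows "reg_rep G g \<circ> reg_rep G h = reg_rep G (g \<otimes> h)"
proof (rule bounded_ops_ext[of _ "carrier G"])
  fix f assume f: "f \<in> L2 (carrier G)"
  have "reg_rep G g (reg_rep G h f) x = reg_rep G (g \<otimes> h) f x" for x
    using g h unfolding reg_rep_apply[OF reg_rep_L2[OF h f]] unfolding reg_rep_apply[OF f]
    by (simp add: inv_mult_group m_assoc)
  then show "(reg_rep G g \<circ> reg_rep G h) f = reg_rep G (g \<otimes> h) f"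
    by (simp add: fun_eq_iff)
qed (use g h reg_rep_bounded in simp_all)

lemma reg_rep_one: "reg_rep G \<one> = id_op (carrier G)"
proof (rule bounded_ops_ext[of _ "carrier G"])
  fix f assume f: "f \<in> L2 (carrier G)"
  then show "reg_rep G \<one> f = id_op (carrier G) f"
    by (auto simp: reg_rep_apply id_op_def fun_eq_iff L2_outside)
qed (simp_all add: reg_rep_bounded)

text \<open>Translation by \<open>g\<close> permutes the carrier, so substituting
  \<open>g \<otimes> x\<close> for \<open>x\<close> in the sum moves the operator to the other
  argument.\<close>

lemma is_adjoint_reg_rep:
  assumes g: "g \<in> carrier G"
  shows "is_adjoint (carrier G) (reg_rep G g) (reg_rep G (inv g))"
  unfolding is_adjoint_def
proof (intro conjI ballI)
  fix f h assume f: "f \<in> L2 (carrier G)" and h: "h \<in> L2 (carrier G)"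
  have "L2_inner (carrier G) (reg_rep G (inv g) f) h
      = (\<Sum>\<^sub>\<infinity>x\<in>carrier G. cnj (f (g \<otimes> x)) * h (inv g \<otimes> (g \<otimes> x)))"
    unfolding L2_inner_def
    by (rule infsum_cong) (use g in \<open>simp add: reg_rep_apply[OF f] m_assoc[symmetric]\<close>)
  also have "\<dots> = (\<Sum>\<^sub>\<infinity>x\<in>carrier G. cnj (f x) * h (inv g \<otimes> x))"
    by (rule infsum_reindex_bij_betw[OF bij_betw_left_mult[OF g], of "\<lambda>x. cnj (f x) * h (inv g \<otimes> x)"])
  also have "\<dots> = L2_inner (carrier G) f (reg_rep G g h)"
    unfolding L2_inner_def by (rule infsum_cong) (simp add: reg_rep_apply[OF h])
  finally show "L2_inner (carrier G) (reg_rep G (inv g) f) h = L2_inner (carrier G) f (reg_rep G g h)" .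
qed (use g in \<open>auto intro: reg_rep_bounded\<close>)

lemma reg_rep_delta:
  assumes g: "g \<in> carrier G" and x: "x \<in> carrier G"
  shows "reg_rep G g (delta x) = delta (g \<otimes> x)"
proof
  fix y
  have "inv g \<otimes> y = x \<longleftrightarrow> y = g \<otimes> x" if "y \<in> carrier G"
    using that assms inv_solve_left' by metis
  then show "reg_rep G g (delta x) y = delta (g \<otimes> x) y"
    unfolding reg_rep_apply[OF delta_L2[OF x]] using assms by (auto simp: delta_def)
qed

lemma star_semigroup_reg_rep: "star_semigroup (carrier G) (reg_rep G ` carrier G)"
  by unfold_locales (use is_adjoint_reg_rep in \<open>auto simp: reg_rep_mult\<close>)

lemma reg_rep_in_reduced_cstar: "g \<in> carrier G \<Longrightarrow> reg_rep G g \<in> reduced_cstar G"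
  unfolding reduced_cstar_def using generated_cstar_inc by blast

lemma cstar_subalgebra_reduced_cstar: "cstar_subalgebra (carrier G) (reduced_cstar G)"
  unfolding reduced_cstar_def by (rule cstar_subalgebra_generated) (auto intro: reg_rep_bounded)

lemma id_op_in_reduced_cstar: "id_op (carrier G) \<in> reduced_cstar G"
  using reg_rep_in_reduced_cstar[OF one_closed] by (simp add: reg_rep_one)

end

section \<open>Density matrices\<close>

text \<open>Positivity of the compression of \<open>\<rho>\<close> to the span of two basis vectors, in the additive form
  that the summation over the diagonal needs.\<close>

lemma positive_op_off_diagonal:
  assumes \<rho>: "positive_op X \<rho>" and x: "x \<in> X" and y: "y \<in> X" and t: "t > 0"
  shows "2 * cmod (\<rho> (delta y) x) \<le> t * Re (\<rho> (delta x) x) + Re (\<rho> (delta y) y) / t"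
proof -
  have bd: "\<rho> \<in> bounded_ops X" and pos: "f \<in> L2 X \<Longrightarrow> L2_inner X f (\<rho> f) \<in> \<real>\<^sub>\<ge>\<^sub>0" for f
    using \<rho> by (auto simp: positive_op_def)
  define p where "p = \<rho> (delta x) x"
  define q where "q = \<rho> (delta y) y"
  define u where "u = \<rho> (delta y) x"
  define v where "v = \<rho> (delta x) y"
  \<comment> \<open>The quadratic form of \<rho> on the combination of the two basis vectors with
    coefficients \<open>a\<close> and \<open>b\<close>.\<close>
  have form: "cnj a * a * p + cnj b * b * q + cnj a * b * u + cnj b * a * v \<in> \<real>\<^sub>\<ge>\<^sub>0" for a b
  proof -
    let ?f = "vec_scale a (delta x) + vec_scale b (delta y)"
    have L2: "\<rho> (delta x) \<in> L2 X" "\<rho> (delta y) \<in> L2 X" using bd by auto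
    have "L2_inner X ?f (\<rho> ?f) = L2_inner X ?f (vec_scale a (\<rho> (delta x)) + vec_scale b (\<rho> (delta y)))"
      using x y by (simp add: bounded_ops_add[OF bd] bounded_ops_scale[OF bd])
    also have "\<dots> = cnj a * a * p + cnj b * b * q + cnj a * b * u + cnj b * a * v"
      using x y L2
      by (simp add: L2_inner_add_left L2_inner_add_right L2_inner_scale_left L2_inner_scale_right
          L2_inner_delta p_def q_def u_def v_def algebra_simps)
    finally show ?thesis using pos[of ?f] x y by simp
  qed
  have p: "Im p = 0" and q: "Im q = 0"
    using form[of 1 0] form[of 0 1] by (auto simp: complex_nonneg_Reals_iff)
  \<comment> \<open>Realness of the form at (1, 1) and at (1, \<i>) forces the off-diagonal entries
    to be conjugate.\<close>
  have "Im (u + v) = 0" "Re (u - v) = 0"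
    using form[of 1 1] form[of 1 \<i>] p q by (auto simp: complex_nonneg_Reals_iff)
  then have v: "v = cnj u" by (simp add: complex_eq_iff)
  show ?thesis
  proof (cases "u = 0")
    case True
    have "Re p \<ge> 0" "Re q \<ge> 0"
      using form[of 1 0] form[of 0 1] by (auto simp: complex_nonneg_Reals_iff)
    with True t show ?thesis unfolding u_def p_def q_def by simp
  next
    case False
    \<comment> \<open>The coefficients \<open>s\<close> and \<open>w\<close> have modulus sqrt t and
      1 / sqrt t. The phase of \<open>w\<close> turns each cross term into minus the modulus of
      \<open>u\<close>; \<open>u = 0\<close> was split off because it has no phase.\<close>
    define s where "s = complex_of_real (sqrt t)"
    define w where "w = - cnj u / (complex_of_real (cmod u) * s)"
    have s: "s \<noteq> 0" "cnj s = s" "s * s = complex_of_real t"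
      using t by (simp_all add: s_def flip: of_real_mult)
    have uu: "cnj u * u = complex_of_real (cmod u) * complex_of_real (cmod u)"
      using complex_norm_square[of u] by (simp add: power2_eq_square mult.commute)
    have ww: "cnj w * w = complex_of_real (1 / t)"
    proof -
      have "cnj w * w = (cnj u * u) / ((complex_of_real (cmod u) * complex_of_real (cmod u)) * (s * s))"
        using s(1,2) by (simp add: w_def mult_ac)
      then show ?thesis using False by (simp add: uu s(3))
    qed
    have su: "cnj s * w * u = - complex_of_real (cmod u)"
    proof -
      have "cnj s * w * u = - (cnj u * u) / complex_of_real (cmod u)"
        using s by (simp add: w_def)
      then show ?thesis using False by (simp add: uu)
    qed
    have sv: "cnj w * s * v = - complex_of_real (cmod u)"
      using arg_cong[OF su, of cnj] by (simp add: v mult_ac)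
    have "complex_of_real t * p + complex_of_real (1 / t) * q - 2 * complex_of_real (cmod u) \<in> \<real>\<^sub>\<ge>\<^sub>0"
      using form[of s w] s unfolding ww su sv by simp
    then show ?thesis
      unfolding complex_nonneg_Reals_iff by (simp add: u_def p_def q_def)
  qed
qed

text \<open>The trace is the sum of the entries of \<rho> at (x, h x). Almost all diagonal mass sits
  on a finite set \<open>J\<close>; if \<open>h\<close> moves \<open>J\<close> off itself, each
  entry has an index outside \<open>J\<close>, and positivity transfers the smallness of the
  diagonal there to the entry.\<close>

lemma (in group) density_matrix_vanishes_at_infinity:
  assumes \<rho>: "density_matrix (carrier G) \<rho>" and \<epsilon>: "\<epsilon> > 0"
  shows "\<exists>K. finite K \<and> (\<forall>h\<in>carrier G - K. cmod (op_trace (carrier G) (\<rho> \<circ> reg_rep G h)) \<le> \<epsilon>)"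
proof -
  let ?X = "carrier G"
  \<comment> \<open>The trace will be bounded by \<open>R / e + e\<close> with tail mass
    \<open>R \<le> e\<^sup>2\<close>, hence by 2 e.\<close>
  define e where "e = \<epsilon> / 2"
  have e: "e > 0" using \<epsilon> by (simp add: e_def)
  have pos: "positive_op ?X \<rho>" and summ: "(\<lambda>x. L2_inner ?X (delta x) (\<rho> (delta x))) summable_on ?X"
    and tr: "op_trace ?X \<rho> = 1"
    using \<rho> by (auto simp: density_matrix_def)
  define r where "r x = Re (\<rho> (delta x) x)" for x
  have r_nonneg: "r x \<ge> 0" if "x \<in> ?X" for x
  proof -
    have "L2_inner ?X (delta x) (\<rho> (delta x)) \<in> \<real>\<^sub>\<ge>\<^sub>0"
      using pos that by (simp add: positive_op_def)
    then show ?thesis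
      using that by (simp add: L2_inner_delta complex_nonneg_Reals_iff r_def)
  qed
  have "((\<lambda>x. L2_inner ?X (delta x) (\<rho> (delta x))) has_sum 1) ?X"
    using summ tr by (simp add: op_trace_def has_sum_iff)
  then have "((\<lambda>x. Re (L2_inner ?X (delta x) (\<rho> (delta x)))) has_sum Re 1) ?X"
    by (rule has_sum_Re)
  then have "(r has_sum Re 1) ?X"
    by (rule has_sum_cong[THEN iffD1, rotated]) (simp_all add: L2_inner_delta r_def)
  then have r1: "(r has_sum 1) ?X" by simp
  obtain J where J: "finite J" "J \<subseteq> ?X" "dist (sum r J) 1 \<le> e\<^sup>2"
    using has_sum_finite_approximation[OF r1, of "e\<^sup>2"] e by auto
  define r' where "r' x = (if x \<in> J then 0 else r x)" for x
  define R where "R = 1 - sum r J"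
  have R: "R \<le> e\<^sup>2" using J(3) by (auto simp: R_def dist_real_def)
  have "((\<lambda>x. if x \<in> J then r x else 0) has_sum (sum r J)) ?X"
    by (rule has_sum_finite_neutralI[OF J(1)]) (use J in auto)
  then have "((\<lambda>x. r x + - (if x \<in> J then r x else 0)) has_sum (1 + - sum r J)) ?X"
    by (intro has_sum_add r1 has_sum_uminus[THEN iffD2]) simp
  moreover have "(\<lambda>x. r x + - (if x \<in> J then r x else 0)) = r'"
    by (auto simp: r'_def)
  ultimately have r'R: "(r' has_sum R) ?X" by (simp add: R_def)
  \<comment> \<open>These are exactly the quotients of points of \<open>J\<close>, so any
    \<open>h\<close> outside \<open>K\<close> sends no point of \<open>J\<close> into
    \<open>J\<close>.\<close>
  define K where "K = (\<lambda>(i, j). j \<otimes> inv i) ` (J \<times> J)"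
  have "cmod (op_trace ?X (\<rho> \<circ> reg_rep G h)) \<le> \<epsilon>" if h: "h \<in> ?X" "h \<notin> K" for h
  proof -
    have escape: "h \<otimes> x \<notin> J" if "x \<in> J" for x
    proof
      assume "h \<otimes> x \<in> J"
      moreover have "h = (h \<otimes> x) \<otimes> inv x" using that h J by (auto simp: m_assoc)
      ultimately show False using h(2) that by (force simp: K_def)
    qed
    define m where "m x = L2_inner ?X (delta x) ((\<rho> \<circ> reg_rep G h) (delta x))" for x
    \<comment> \<open>If \<open>x\<close> lies in \<open>J\<close>, then
      \<open>h \<otimes> x\<close> does not and carries the weight 1/e; otherwise \<open>x\<close>
      carries it. The other point has weight e. \<open>B\<close> adds the bounds of both cases, each
      nonnegative on the carrier, so its sum \<open>R / e + e\<close> needs no case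
      distinction.\<close>
    define B where "B x = 1 / 2 * (1 / e * r' x + e * r (h \<otimes> x)) + 1 / 2 * (e * r x + 1 / e * r' (h \<otimes> x))" for x
    have shift: "((\<lambda>x. c (h \<otimes> x)) has_sum s) ?X" if "(c has_sum s) ?X" for c :: "_ \<Rightarrow> real" and s
      using has_sum_reindex_bij_betw[OF bij_betw_left_mult[OF h(1)], of c s] that by simp
    have B: "(B has_sum (1 / 2 * (1 / e * R + e * 1) + 1 / 2 * (e * 1 + 1 / e * R))) ?X"
      unfolding B_def by (intro has_sum_add has_sum_cmult_right r'R r1 shift)
    have mB: "cmod (m x) \<le> B x" if x: "x \<in> ?X" for x
    proof -
      have hx: "h \<otimes> x \<in> ?X" using h x by simp
      have m: "m x = \<rho> (delta (h \<otimes> x)) x"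
        using h x by (simp add: m_def L2_inner_delta reg_rep_delta)
      have nonneg: "r x \<ge> 0" "r (h \<otimes> x) \<ge> 0" "r' x \<ge> 0" "r' (h \<otimes> x) \<ge> 0"
        using r_nonneg x hx by (auto simp: r'_def)
      show ?thesis
      proof (cases "x \<in> J")
        case True
        have "2 * cmod (m x) \<le> e * r x + r (h \<otimes> x) / e"
          unfolding m r_def by (rule positive_op_off_diagonal[OF pos x hx e])
        also have "r (h \<otimes> x) = r' (h \<otimes> x)"
          using escape[OF True] by (simp add: r'_def)
        finally have "cmod (m x) \<le> 1 / 2 * (e * r x + 1 / e * r' (h \<otimes> x))" by simp
        moreover have "0 \<le> 1 / 2 * (1 / e * r' x + e * r (h \<otimes> x))"
          using nonneg e by simp
        ultimately show ?thesis unfolding B_def by linarith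
      next
        case False
        have "2 * cmod (m x) \<le> (1 / e) * r x + r (h \<otimes> x) / (1 / e)"
          unfolding m r_def by (rule positive_op_off_diagonal[OF pos x hx]) (use e in simp)
        also have "r x = r' x"
          using False by (simp add: r'_def)
        finally have "cmod (m x) \<le> 1 / 2 * (1 / e * r' x + e * r (h \<otimes> x))" by (simp add: mult.commute)
        moreover have "0 \<le> 1 / 2 * (e * r x + 1 / e * r' (h \<otimes> x))"
          using nonneg e by simp
        ultimately show ?thesis unfolding B_def by linarith
      qed
    qed
    have "(\<lambda>x. cmod (m x)) summable_on ?X"
      by (rule Infinite_Sum.abs_summable_on_comparison_test'[OF has_sum_imp_summable[OF B] mB])
    from has_sum_infsum[OF abs_summable_summable[OF this]]
    have "(m has_sum (op_trace ?X (\<rho> \<circ> reg_rep G h))) ?X"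
      by (simp only: op_trace_def flip: m_def)
    from norm_infsum_le[OF this B mB]
    have "cmod (op_trace ?X (\<rho> \<circ> reg_rep G h)) \<le> R / e + e" by simp argo
    also have "R / e \<le> e\<^sup>2 / e" using R e by (intro divide_right_mono) auto
    also have "e\<^sup>2 / e + e = \<epsilon>" using e by (simp add: power2_eq_square e_def)
    finally show ?thesis by simp
  qed
  moreover have "finite K" using J by (simp add: K_def)
  ultimately show ?thesis by blast
qed

section \<open>Orbits in the free group\<close>

text \<open>Product and unit of \<open>free_group\<close> are given by formulas that do not mention
  \<open>L\<close>, so an inverse over the smaller alphabet is one over the larger.\<close>

lemma subgroup_free_group:
  assumes "M \<subseteq> L"
  shows "subgroup (carrier (free_group M)) (free_group L)"
proof -
  interpret GL: group "free_group L" by (rule group_free_group)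
  interpret GM: group "free_group M" by (rule group_free_group)
  have same: "x \<otimes>\<^bsub>free_group L\<^esub> y = x \<otimes>\<^bsub>free_group M\<^esub> y" "\<one>\<^bsub>free_group L\<^esub> = \<one>\<^bsub>free_group M\<^esub>" for x y
    by (simp_all add: free_group_def)
  have sub: "carrier (free_group M) \<subseteq> carrier (free_group L)"
    using assms by (auto simp: free_group_def)
  show ?thesis
  proof (rule subgroup.intro)
    fix x assume x: "x \<in> carrier (free_group M)"
    have "inv\<^bsub>free_group L\<^esub> x = inv\<^bsub>free_group M\<^esub> x"
      by (rule GL.inv_equality) (use x sub in \<open>auto simp: same\<close>)
    then show "inv\<^bsub>free_group L\<^esub> x \<in> carrier (free_group M)"
      using x by simp
  qed (use sub in \<open>auto simp: same\<close>)
qed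

lemma (in group) foldr_mult_closed:
  "set xs \<subseteq> carrier G \<Longrightarrow> foldr (\<otimes>) xs \<one> \<in> carrier G"
  by (induction xs) auto

text \<open>Otherwise \<open>c\<close> could be solved for inside \<open>N\<close>. The induction
  strips the factors to its left one by one; those to its right form a single element of
  \<open>N\<close>.\<close>

lemma (in group) foldr_mult_notin_subgroup:
  assumes N: "subgroup N G" and c: "c \<in> carrier G" "c \<notin> N" and uv: "set us \<subseteq> N" "set vs \<subseteq> N"
  shows "foldr (\<otimes>) (us @ c # vs) \<one> \<notin> N"
  using uv(1)
proof (induction us)
  case Nil
  have vs: "foldr (\<otimes>) vs \<one> \<in> N"
    using uv(2) by (induction vs) (auto intro: subgroup.m_closed[OF N] subgroup.one_closed[OF N])
  show ?case
  proof
    assume "foldr (\<otimes>) ([] @ c # vs) \<one> \<in> N"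
    then have "(c \<otimes> foldr (\<otimes>) vs \<one>) \<otimes> inv (foldr (\<otimes>) vs \<one>) \<in> N"
      using vs by (auto intro: subgroup.m_closed[OF N] subgroup.m_inv_closed[OF N])
    then show False
      using c vs subgroup.mem_carrier[OF N vs] by (simp add: m_assoc)
  qed
next
  case (Cons u us)
  let ?r = "foldr (\<otimes>) (us @ c # vs) \<one>"
  have u: "u \<in> N" "u \<in> carrier G" using Cons.prems subgroup.mem_carrier[OF N] by auto
  have r: "?r \<in> carrier G"
    using Cons.prems uv c subgroup.mem_carrier[OF N] by (intro foldr_mult_closed) auto
  show ?case
  proof
    assume "foldr (\<otimes>) ((u # us) @ c # vs) \<one> \<in> N"
    then have "inv u \<otimes> (u \<otimes> ?r) \<in> N"
      using u by (auto intro: subgroup.m_closed[OF N] subgroup.m_inv_closed[OF N])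
    then have "?r \<in> N"
      using u r by (simp add: m_assoc[symmetric])
    then show False using Cons by simp
  qed
qed

lemma free_group_map_funpow: "(free_group_map \<sigma> ^^ n) w = free_group_map (\<sigma> ^^ n) w"
  by (induction n) (auto simp: free_group_map_def apfst_def map_prod_def intro!: map_idI[symmetric])

lemma letters_free_group_map: "fst ` set (free_group_map \<tau> w) = \<tau> ` fst ` set w"
  by (simp add: free_group_map_def image_image)

lemma free_group_map_funpow_closed:
  assumes "bij_betw \<sigma> L L" "w \<in> carrier (free_group L)"
  shows "(free_group_map \<sigma> ^^ n) w \<in> carrier (free_group L)"
  using free_group_map_iso[OF bij_betw_funpow[OF assms(1), of n]] assms(2)
  unfolding free_group_map_funpow by (auto simp: iso_def hom_def)

text \<open>If every letter of \<open>g\<close> were periodic, all iterates of \<open>g\<close>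
  would be words of the same length over the finitely many letters in these cycles, and the orbit
  would be finite.\<close>

lemma aperiodic_letter:
  assumes g: "g \<in> carrier (free_group L)" "g \<notin> finite_orbit_points (free_group L) (free_group_map \<sigma>)"
  shows "\<exists>x \<in> fst ` set g. \<forall>d\<ge>1. (\<sigma> ^^ d) x \<noteq> x"
proof (rule ccontr)
  assume "\<not> ?thesis"
  then obtain d where d: "\<And>x. x \<in> fst ` set g \<Longrightarrow> d x \<ge> 1 \<and> (\<sigma> ^^ d x) x = x"
    by metis
  define S where "S = (\<Union>x\<in>fst ` set g. (\<lambda>n. (\<sigma> ^^ n) x) ` {..<d x})"
  have "(\<sigma> ^^ n) x \<in> S" if x: "x \<in> fst ` set g" for n x
  proof -
    have "(\<sigma> ^^ n) x = (\<sigma> ^^ (n mod d x)) x"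
      using funpow_mod_eq[where f = \<sigma> and n = "d x" and x = x and m = n] d[OF x] by simp
    moreover have "n mod d x < d x" using d[OF x] by simp
    ultimately show ?thesis using x unfolding S_def by blast
  qed
  then have "{(free_group_map \<sigma> ^^ n) g |n. n \<ge> 1} \<subseteq> {w. set w \<subseteq> S \<times> UNIV \<and> length w = length g}"
    by (force simp: free_group_map_funpow free_group_map_def)
  moreover have "finite {w. set w \<subseteq> S \<times> (UNIV :: bool set) \<and> length w = length g}"
    by (rule finite_lists_length_eq) (simp add: S_def)
  ultimately have "finite {(free_group_map \<sigma> ^^ n) g |n. n \<ge> 1}"
    by (rule finite_subset)
  then show False using g by (simp add: finite_orbit_points_def)
qed

text \<open>Two hits at times d < e would return \<open>x\<close> to itself after e - d steps, so
  there is at most one. Applied to factors translated further than the one containing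
  \<open>x\<close>.\<close>

lemma finite_hitting_times:
  assumes "\<And>d. d \<ge> 1 \<Longrightarrow> (\<sigma> ^^ d) x \<noteq> x"
  shows "finite {d. (\<sigma> ^^ d) z = x}"
proof -
  have False if "d < e" "(\<sigma> ^^ d) z = x" "(\<sigma> ^^ e) z = x" for d e
  proof -
    have "(\<sigma> ^^ (e - d)) x = (\<sigma> ^^ ((e - d) + d)) z"
      unfolding funpow_add using that by simp
    then show False using that assms[of "e - d"] by simp
  qed
  then have "{d. (\<sigma> ^^ d) z = x} \<subseteq> {e}" if "(\<sigma> ^^ e) z = x" for e
    using that by (auto, metis linorder_cases)
  then show ?thesis
    by (cases "\<exists>e. (\<sigma> ^^ e) z = x") (auto intro: finite_subset)
qed

text \<open>Of two visits at times d < e, injectivity on \<open>L\<close> cancels the first d steps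
  and returns \<open>x\<close> to itself after e - d. Applied to the letters of a fixed word and to
  factors translated less far.\<close>

lemma finite_visit_times:
  assumes \<sigma>: "bij_betw \<sigma> L L" and x: "x \<in> L" "\<And>d. d \<ge> 1 \<Longrightarrow> (\<sigma> ^^ d) x \<noteq> x"
  shows "finite {d. (\<sigma> ^^ d) x = z}"
proof -
  have inj: "inj_on (\<sigma> ^^ d) L" and img: "(\<sigma> ^^ d) x \<in> L" for d
    using bij_betw_funpow[OF \<sigma>, of d] x(1) by (auto simp: bij_betw_def)
  have False if "d < e" "(\<sigma> ^^ d) x = z" "(\<sigma> ^^ e) x = z" for d e
  proof -
    have "(\<sigma> ^^ d) ((\<sigma> ^^ (e - d)) x) = (\<sigma> ^^ (d + (e - d))) x"
      unfolding funpow_add by simp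
    then have "(\<sigma> ^^ d) ((\<sigma> ^^ (e - d)) x) = (\<sigma> ^^ d) x"
      using that by simp
    then have "(\<sigma> ^^ (e - d)) x = x"
      using inj_onD[OF inj] img x(1) by blast
    then show False using that x(2)[of "e - d"] by simp
  qed
  then have "{d. (\<sigma> ^^ d) x = z} \<subseteq> {e}" if "(\<sigma> ^^ e) x = z" for e
    using that by (auto, metis linorder_cases)
  then show ?thesis
    by (cases "\<exists>e. (\<sigma> ^^ e) x = z") (auto intro: finite_subset)
qed

section \<open>Times with growing gaps\<close>

lemma eventually_gap_Suc:
  assumes "1 \<le> j" "j < k"
  shows "\<forall>\<^sub>F n in gaps_at_top k. int (n (Suc j)) - int (n j) \<ge> c"
proof -
  have "gaps_at_top k \<le> filtercomap (\<lambda>n. int (n (j + 1)) - int (n j)) at_top"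
    unfolding gaps_at_top_def by (rule le_infI2, rule INF_lower) (use assms in simp)
  then have "filterlim (\<lambda>n. int (n (j + 1)) - int (n j)) at_top (gaps_at_top k)"
    by (simp add: filterlim_iff_le_filtercomap)
  then show ?thesis by (simp add: filterlim_at_top)
qed

text \<open>Consecutive gaps telescope: the first provides the margin \<open>c + 1\<close>, the
  others only have to be nonnegative.\<close>

lemma eventually_gap:
  assumes "1 \<le> i" "i < j" "j \<le> k"
  shows "\<forall>\<^sub>F n in gaps_at_top k. n j > n i + c"
proof -
  have "\<forall>\<^sub>F n in gaps_at_top k. int (n j) - int (n i) \<ge> int c + 1"
    if "Suc i \<le> j" "j \<le> k" for j
    using that
  proof (induction j rule: dec_induct)
    case base
    then show ?case using eventually_gap_Suc[of i k] assms(1) by simp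
  next
    case (step j)
    have "\<forall>\<^sub>F n in gaps_at_top k. int (n j) - int (n i) \<ge> int c + 1"
      using step by simp
    moreover have "\<forall>\<^sub>F n in gaps_at_top k. int (n (Suc j)) - int (n j) \<ge> 0"
      by (rule eventually_gap_Suc) (use step assms in auto)
    ultimately show ?case by eventually_elim simp
  qed
  from this[of j] have "\<forall>\<^sub>F n in gaps_at_top k. int (n j) - int (n i) \<ge> int c + 1"
    using assms by simp
  then show ?thesis by eventually_elim simp
qed

lemma eventually_time:
  assumes "1 \<le> i" "i \<le> k"
  shows "\<forall>\<^sub>F n in gaps_at_top k. n i > c"
proof -
  have "gaps_at_top k \<le> filtercomap (\<lambda>n. n 1) at_top"
    unfolding gaps_at_top_def by (rule le_infI1) simp
  then have "filterlim (\<lambda>n. n 1) at_top (gaps_at_top k)"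
    by (simp add: filterlim_iff_le_filtercomap)
  then have "\<forall>\<^sub>F n in gaps_at_top k. n 1 \<ge> Suc c"
    unfolding filterlim_at_top by blast
  then have 1: "\<forall>\<^sub>F n in gaps_at_top k. n 1 > c"
    by eventually_elim simp
  show ?thesis
  proof (cases "i = 1")
    case False
    then have "\<forall>\<^sub>F n in gaps_at_top k. n i > n 1 + 0"
      by (intro eventually_gap) (use assms in auto)
    with 1 show ?thesis by eventually_elim simp
  qed (use 1 in simp)
qed

lemma upt_split:
  assumes "j \<in> {1..k}"
  shows "[1..<k + 1] = [1..<j] @ j # [j + 1..<k + 1]"
  using assms upt_add_eq_append[of 1 j "k + 1 - j"] by (simp add: upt_conv_Cons del: upt_Suc)

text \<open>Past some time the letter \<open>(\<sigma> ^^ n (p i0)) x\<close> occurs in exactly one factor, and not in \<open>w\<close>;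
  the words avoiding it form a subgroup.\<close>

lemma eventually_product_neq:
  assumes \<sigma>: "bij_betw \<sigma> L L" and p: "p permutes {1..k}"
    and g: "\<And>i. i \<in> {1..k} \<Longrightarrow> g i \<in> carrier (free_group L)"
    and i0: "i0 \<in> {1..k}" "g i0 \<notin> finite_orbit_points (free_group L) (free_group_map \<sigma>)"
  shows "\<forall>\<^sub>F n in gaps_at_top k.
    foldr (\<otimes>\<^bsub>free_group L\<^esub>) (map (\<lambda>i. (free_group_map \<sigma> ^^ n (p i)) (g i)) [1..<k + 1]) \<one>\<^bsub>free_group L\<^esub> \<noteq> w"
proof (cases "w \<in> carrier (free_group L)")
  case w: True
  interpret group "free_group L" by (rule group_free_group)
  have pk: "p i \<in> {1..k}" if "i \<in> {1..k}" for i
    using permutes_in_image[OF p] that by blast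
  obtain x where x: "x \<in> fst ` set (g i0)" "\<And>d. d \<ge> 1 \<Longrightarrow> (\<sigma> ^^ d) x \<noteq> x"
    using aperiodic_letter[OF g[OF i0(1)] i0(2)] by blast
  have letters: "fst ` set v \<subseteq> L" if "v \<in> carrier (free_group L)" for v
    using that by (simp add: free_group_def)
  have xL: "x \<in> L" using letters[OF g[OF i0(1)]] x(1) by blast
  have inj: "inj_on (\<sigma> ^^ d) L" and img: "y \<in> L \<Longrightarrow> (\<sigma> ^^ d) y \<in> L" for d y
    using bij_betw_funpow[OF \<sigma>, of d] by (auto simp: bij_betw_def)
  \<comment> \<open>The orbit of \<open>x\<close> meets each of the finitely many letters of
    \<open>w\<close> at finitely many times only.\<close>
  have E1: "\<forall>\<^sub>F n in gaps_at_top k. \<forall>z\<in>fst ` set w. (\<sigma> ^^ n (p i0)) x \<noteq> z"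
  proof (intro eventually_ball_finite ballI)
    fix z
    obtain c where "\<forall>d\<in>{d. (\<sigma> ^^ d) x = z}. d \<le> c"
      using finite_visit_times[OF \<sigma> xL x(2), of z] finite_nat_set_iff_bounded_le by blast
    moreover have "\<forall>\<^sub>F n in gaps_at_top k. n (p i0) > c"
      by (rule eventually_time) (use pk[OF i0(1)] in auto)
    ultimately show "\<forall>\<^sub>F n in gaps_at_top k. (\<sigma> ^^ n (p i0)) x \<noteq> z"
      by (auto elim!: eventually_mono)
  qed simp
  \<comment> \<open>The smaller of the two times is cancelled by injectivity of the iterate on
    \<open>L\<close>. What remains is one letter reaching another after the difference of the times,
    which is possible for finitely many differences.\<close>
  have E2: "\<forall>\<^sub>F n in gaps_at_top k. \<forall>i\<in>{1..k} - {i0}. \<forall>z\<in>fst ` set (g i).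
      (\<sigma> ^^ n (p i0)) x \<noteq> (\<sigma> ^^ n (p i)) z"
  proof (intro eventually_ball_finite ballI)
    fix i z assume i: "i \<in> {1..k} - {i0}" and z: "z \<in> fst ` set (g i)"
    have zL: "z \<in> L" using letters[OF g] i z by blast
    have "p i \<noteq> p i0"
      using i permutes_inj[OF p] by (auto dest: injD)
    then consider "p i < p i0" | "p i0 < p i" by linarith
    then show "\<forall>\<^sub>F n in gaps_at_top k. (\<sigma> ^^ n (p i0)) x \<noteq> (\<sigma> ^^ n (p i)) z"
    proof cases
      case 1
      obtain c where c: "\<forall>d\<in>{d. (\<sigma> ^^ d) x = z}. d \<le> c"
        using finite_visit_times[OF \<sigma> xL x(2), of z] finite_nat_set_iff_bounded_le by blast
      have "\<forall>\<^sub>F n in gaps_at_top k. n (p i0) > n (p i) + c"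
        by (rule eventually_gap) (use pk[OF i0(1)] pk[of i] i 1 in auto)
      then show ?thesis
      proof eventually_elim
        case (elim n)
        have "(\<sigma> ^^ n (p i0)) x = (\<sigma> ^^ (n (p i) + (n (p i0) - n (p i)))) x"
          using elim by simp
        then have "(\<sigma> ^^ n (p i0)) x = (\<sigma> ^^ n (p i)) ((\<sigma> ^^ (n (p i0) - n (p i))) x)"
          unfolding funpow_add by simp
        then show ?case
          using inj_onD[OF inj, of "n (p i)" _ z] img[OF xL] zL c elim by fastforce
      qed
    next
      case 2
      obtain c where c: "\<forall>d\<in>{d. (\<sigma> ^^ d) z = x}. d \<le> c"
        using finite_hitting_times[OF x(2), of z] finite_nat_set_iff_bounded_le by blast
      have "\<forall>\<^sub>F n in gaps_at_top k. n (p i) > n (p i0) + c"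
        by (rule eventually_gap) (use pk[OF i0(1)] pk[of i] i 2 in auto)
      then show ?thesis
      proof eventually_elim
        case (elim n)
        have "(\<sigma> ^^ n (p i)) z = (\<sigma> ^^ (n (p i0) + (n (p i) - n (p i0)))) z"
          using elim by simp
        then have "(\<sigma> ^^ n (p i)) z = (\<sigma> ^^ n (p i0)) ((\<sigma> ^^ (n (p i) - n (p i0))) z)"
          unfolding funpow_add by simp
        then show ?case
          using inj_onD[OF inj, of "n (p i0)" x] img[OF zL] xL c elim by fastforce
      qed
    qed
  qed auto
  from E1 E2 show ?thesis
  proof eventually_elim
    case (elim n)
    define y where "y = (\<sigma> ^^ n (p i0)) x"
    define N where "N = carrier (free_group (L - {y}))"
    let ?h = "\<lambda>i. (free_group_map \<sigma> ^^ n (p i)) (g i)"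
    have N: "subgroup N (free_group L)"
      unfolding N_def by (rule subgroup_free_group) simp
    have N_iff: "v \<in> N \<longleftrightarrow> y \<notin> fst ` set v" if "v \<in> carrier (free_group L)" for v
      using that by (auto simp: N_def free_group_def)
    have h: "?h i \<in> carrier (free_group L)" if "i \<in> {1..k}" for i
      using free_group_map_funpow_closed[OF \<sigma> g[OF that]] .
    have h_letters: "fst ` set (?h i) = (\<sigma> ^^ n (p i)) ` fst ` set (g i)" for i
      by (simp only: free_group_map_funpow letters_free_group_map)
    have others: "?h i \<in> N" if "i \<in> {1..k} - {i0}" for i
    proof -
      have "\<forall>z\<in>fst ` set (g i). y \<noteq> (\<sigma> ^^ n (p i)) z"
        using bspec[OF elim(2) that] by (simp only: y_def)
      then show ?thesis
        unfolding N_iff[OF h[OF DiffD1[OF that]]] h_letters by blast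
    qed
    have "w \<in> N"
    proof -
      have "\<forall>z\<in>fst ` set w. y \<noteq> z"
        using elim(1) by (simp only: y_def)
      then show ?thesis unfolding N_iff[OF w] by blast
    qed
    moreover have "?h i0 \<notin> N"
      unfolding N_iff[OF h[OF i0(1)]] h_letters y_def not_not by (rule imageI[OF x(1)])
    then have "foldr (\<otimes>\<^bsub>free_group L\<^esub>) (map ?h [1..<i0] @ ?h i0 # map ?h [i0 + 1..<k + 1]) \<one>\<^bsub>free_group L\<^esub> \<notin> N"
      by (intro foldr_mult_notin_subgroup[OF N h[OF i0(1)]]) (use i0 in \<open>auto intro!: others\<close>)
    moreover have "map ?h [1..<k + 1] = map ?h [1..<i0] @ ?h i0 # map ?h [i0 + 1..<k + 1]"
      unfolding upt_split[OF i0(1)] by (simp only: map_append list.map)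
    ultimately show ?case by metis
  qed
next
  \<comment> \<open>A list that is not a reduced word over \<open>L\<close> is never the value of a
    product in the group.\<close>
  case False
  interpret group "free_group L" by (rule group_free_group)
  have "foldr (\<otimes>\<^bsub>free_group L\<^esub>) (map (\<lambda>i. (free_group_map \<sigma> ^^ n (p i)) (g i)) [1..<k + 1]) \<one>\<^bsub>free_group L\<^esub>
      \<in> carrier (free_group L)" (is "?P n \<in> _") for n
    by (rule foldr_mult_closed) (auto intro!: free_group_map_funpow_closed[OF \<sigma> g])
  then have "\<forall>n. ?P n \<noteq> w" using False by blast
  then show ?thesis by (rule always_eventually)
qed

section \<open>Products of translates\<close>

text \<open>Splits a product at an arbitrary place; boundedness of \<open>R\<close> makes
  \<open>id_op X\<close> act on it as a left unit.\<close>

lemma foldr_comp_id_op: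
  assumes "R \<in> bounded_ops X"
  shows "foldr (\<circ>) bs R = foldr (\<circ>) bs (id_op X) \<circ> R"
  using assms by (induction bs) (simp_all add: comp_assoc)

lemma (in group) foldr_reg_rep:
  assumes "set gs \<subseteq> carrier G"
  shows "foldr (\<circ>) (map (reg_rep G) gs) (id_op (carrier G)) = reg_rep G (foldr (\<otimes>) gs \<one>)"
  using assms by (induction gs) (simp_all add: reg_rep_one reg_rep_mult foldr_mult_closed)

context unital_star_endomorphism
begin

lemma A_closed_subspace: "closed_subspace X A"
  by (rule cstar_subalgebraD(1)[OF A])

lemma A_bounded: "a \<in> A \<Longrightarrow> a \<in> bounded_ops X"
  by (rule closed_subspaceD(1)[OF A_closed_subspace])

lemma funpow_closed: "a \<in> A \<Longrightarrow> (\<theta> ^^ n) a \<in> A"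
  by (induction n) (simp_all add: closed)

lemma funpow_add: "a \<in> A \<Longrightarrow> b \<in> A \<Longrightarrow> (\<theta> ^^ n) (a + b) = (\<theta> ^^ n) a + (\<theta> ^^ n) b"
  by (induction n) (simp_all add: add funpow_closed)

lemma funpow_scale: "a \<in> A \<Longrightarrow> (\<theta> ^^ n) (op_scale c a) = op_scale c ((\<theta> ^^ n) a)"
  by (induction n) (simp_all add: scale funpow_closed)

text \<open>The bound is the same for all exponents, which makes approximation in one slot uniform
  in the times.\<close>

lemma funpow_contractive: "a \<in> A \<Longrightarrow> op_norm X ((\<theta> ^^ n) a) \<le> op_norm X a"
  by (induction n) (auto intro: order_trans[OF contractive] simp: funpow_closed)

lemma foldr_comp_closed:
  "set bs \<subseteq> A \<Longrightarrow> foldr (\<circ>) bs (id_op X) \<in> A"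
  by (induction bs) (simp_all add: id_op_in cstar_subalgebraD(2)[OF A])

lemma foldr_comp_norm:
  assumes "\<And>i. i \<in> set xs \<Longrightarrow> b i \<in> A \<and> op_norm X (b i) \<le> c i"
  shows "op_norm X (foldr (\<circ>) (map b xs) (id_op X)) \<le> prod_list (map c xs)"
  using assms
proof (induction xs)
  case (Cons i xs)
  let ?Q = "foldr (\<circ>) (map b xs) (id_op X)"
  have Q: "?Q \<in> A" using Cons.prems by (intro foldr_comp_closed) auto
  have i: "b i \<in> A" "op_norm X (b i) \<le> c i" using Cons.prems[of i] by auto
  have "op_norm X (b i \<circ> ?Q) \<le> op_norm X (b i) * op_norm X ?Q"
    by (intro op_norm_comp A_bounded i Q)
  also have "\<dots> \<le> c i * prod_list (map c xs)"
  proof (intro mult_mono i op_norm_nonneg A_bounded Q)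
    show "op_norm X ?Q \<le> prod_list (map c xs)"
      by (rule Cons.IH, rule Cons.prems) simp
    show "0 \<le> c i" using i(2) op_norm_nonneg[OF A_bounded[OF i(1)]] by linarith
  qed
  finally have le: "op_norm X (b i \<circ> ?Q) \<le> c i * prod_list (map c xs)" .
  have eq: "foldr (\<circ>) (b i # map b xs) (id_op X) = b i \<circ> ?Q" by simp
  show ?case unfolding eq list.map prod_list.Cons by (rule le)
qed (simp add: op_norm_id_op)

text \<open>All factors except the \<open>j\<close>-th are frozen into \<open>P\<close> and
  \<open>Q\<close>. The constant is chosen before the times: contractivity bounds both blocks by the
  norms of the untranslated factors, whatever \<open>m\<close> is.\<close>

lemma ordered_product_slot:
  assumes a: "\<And>i. i \<in> {1..k} \<Longrightarrow> a i \<in> A" and j: "j \<in> {1..k}"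
  shows "\<exists>C. \<forall>m. \<exists>P\<in>A. \<exists>Q\<in>A. op_norm X P * op_norm X Q \<le> C \<and>
    (\<forall>u\<in>A. ordered_product X k (\<lambda>i. (\<theta> ^^ m i) ((a(j := u)) i)) = P \<circ> ((\<theta> ^^ m j) u \<circ> Q))"
proof (intro exI allI)
  fix m :: "nat \<Rightarrow> nat"
  let ?xs = "[1..<j]" and ?ys = "[j + 1..<k + 1]"
  define prd where "prd xs = foldr (\<circ>) (map (\<lambda>i. (\<theta> ^^ m i) (a i)) xs) (id_op X)" for xs
  have in_range: "set ?xs \<subseteq> {1..k}" "set ?ys \<subseteq> {1..k}" using j by auto
  have prd: "prd xs \<in> A" "op_norm X (prd xs) \<le> prod_list (map (\<lambda>i. op_norm X (a i)) xs)"
    if "set xs \<subseteq> {1..k}" for xs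
  proof -
    have "(\<theta> ^^ m i) (a i) \<in> A \<and> op_norm X ((\<theta> ^^ m i) (a i)) \<le> op_norm X (a i)" if "i \<in> set xs" for i
      using a[OF subsetD[OF \<open>set xs \<subseteq> {1..k}\<close> that]] funpow_closed funpow_contractive by blast
    then show "prd xs \<in> A" "op_norm X (prd xs) \<le> prod_list (map (\<lambda>i. op_norm X (a i)) xs)"
      unfolding prd_def by (intro foldr_comp_closed foldr_comp_norm; force)+
  qed
  have "op_norm X (prd ?xs) * op_norm X (prd ?ys)
      \<le> prod_list (map (\<lambda>i. op_norm X (a i)) ?xs) * prod_list (map (\<lambda>i. op_norm X (a i)) ?ys)"
  proof (intro mult_mono prd in_range op_norm_nonneg A_bounded)
    show "0 \<le> prod_list (map (\<lambda>i. op_norm X (a i)) ?xs)"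
      using prd(2)[OF in_range(1)] op_norm_nonneg[OF A_bounded[OF prd(1)[OF in_range(1)]]] by linarith
  qed
  moreover have "ordered_product X k (\<lambda>i. (\<theta> ^^ m i) ((a(j := u)) i)) = prd ?xs \<circ> ((\<theta> ^^ m j) u \<circ> prd ?ys)"
    if u: "u \<in> A" for u
  proof -
    have maps: "map (\<lambda>i. (\<theta> ^^ m i) ((a(j := u)) i)) xs = map (\<lambda>i. (\<theta> ^^ m i) (a i)) xs"
      if "j \<notin> set xs" for xs
      using that by (intro map_cong) auto
    have "(\<theta> ^^ m j) u \<circ> prd ?ys \<in> bounded_ops X"
      by (intro bounded_ops_comp A_bounded funpow_closed u prd in_range)
    from foldr_comp_id_op[OF this, of "map (\<lambda>i. (\<theta> ^^ m i) (a i)) ?xs"]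
    have shift: "foldr (\<circ>) (map (\<lambda>i. (\<theta> ^^ m i) (a i)) ?xs) ((\<theta> ^^ m j) u \<circ> prd ?ys)
        = prd ?xs \<circ> ((\<theta> ^^ m j) u \<circ> prd ?ys)"
      unfolding prd_def .
    have split: "ordered_product X k b = foldr (\<circ>) (map b ?xs) (b j \<circ> foldr (\<circ>) (map b ?ys) (id_op X))" for b
      unfolding ordered_product_def upt_split[OF j] by (simp del: upt_Suc)
    have "j \<notin> set ?xs" "j \<notin> set ?ys" by auto
    then show ?thesis
      using shift unfolding split maps[OF \<open>j \<notin> set ?xs\<close>] maps[OF \<open>j \<notin> set ?ys\<close>] fun_upd_same prd_def by blast
  qed
  ultimately show "\<exists>P\<in>A. \<exists>Q\<in>A. op_norm X P * op_norm X Q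
      \<le> prod_list (map (\<lambda>i. op_norm X (a i)) ?xs) * prod_list (map (\<lambda>i. op_norm X (a i)) ?ys) \<and>
    (\<forall>u\<in>A. ordered_product X k (\<lambda>i. (\<theta> ^^ m i) ((a(j := u)) i)) = P \<circ> ((\<theta> ^^ m j) u \<circ> Q))"
    using prd(1) in_range by blast
qed

end

text \<open>The constant \<open>K\<close> does not depend on \<open>n\<close>, so replacing
  \<open>a\<close> by an approximant costs less than e/2 for all \<open>n\<close> at once, and the
  approximant already has the limit.\<close>

lemma closed_subspace_null_limits:
  fixes \<Phi> :: "'n \<Rightarrow> 'g op \<Rightarrow> complex"
  assumes A: "closed_subspace X A"
    and add: "\<And>n a b. a \<in> A \<Longrightarrow> b \<in> A \<Longrightarrow> \<Phi> n (a + b) = \<Phi> n a + \<Phi> n b"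
    and scale: "\<And>n c a. a \<in> A \<Longrightarrow> \<Phi> n (op_scale c a) = c * \<Phi> n a"
    and bound: "\<And>n a. a \<in> A \<Longrightarrow> cmod (\<Phi> n a) \<le> K * op_norm X a"
  shows "closed_subspace X {a \<in> A. ((\<lambda>n. \<Phi> n a) \<longlongrightarrow> 0) F}"
proof (rule closed_subspaceI)
  show "{a \<in> A. ((\<lambda>n. \<Phi> n a) \<longlongrightarrow> 0) F} \<subseteq> bounded_ops X"
    using closed_subspaceD(1)[OF A] by blast
  have "\<Phi> n 0 = 0" for n
    using bound[OF closed_subspaceD(2)[OF A], of n] by simp
  then show "0 \<in> {a \<in> A. ((\<lambda>n. \<Phi> n a) \<longlongrightarrow> 0) F}"
    using closed_subspaceD(2)[OF A] by simp
  show "a + b \<in> {a \<in> A. ((\<lambda>n. \<Phi> n a) \<longlongrightarrow> 0) F}"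
    if "a \<in> {a \<in> A. ((\<lambda>n. \<Phi> n a) \<longlongrightarrow> 0) F}" "b \<in> {a \<in> A. ((\<lambda>n. \<Phi> n a) \<longlongrightarrow> 0) F}" for a b
    using that closed_subspaceD(3)[OF A, of a b] tendsto_add[of "\<lambda>n. \<Phi> n a" 0 F "\<lambda>n. \<Phi> n b" 0]
    by (simp add: add)
  show "op_scale c a \<in> {a \<in> A. ((\<lambda>n. \<Phi> n a) \<longlongrightarrow> 0) F}"
    if "a \<in> {a \<in> A. ((\<lambda>n. \<Phi> n a) \<longlongrightarrow> 0) F}" for c a
    using that closed_subspaceD(4)[OF A, of a c] tendsto_mult_left[of "\<lambda>n. \<Phi> n a" 0 F c]
    by (simp add: scale)
  fix s :: "nat \<Rightarrow> 'g op" and a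
  assume s: "\<And>m. s m \<in> {a \<in> A. ((\<lambda>n. \<Phi> n a) \<longlongrightarrow> 0) F}" and a: "a \<in> bounded_ops X"
    and lim: "(\<lambda>m. op_norm X (s m - a)) \<longlonglongrightarrow> 0"
  have sA: "s m \<in> A" for m using s[of m] by simp
  have aA: "a \<in> A"
    by (rule closed_subspaceD(5)[OF A, of s]) (fact sA a lim)+
  have "((\<lambda>n. \<Phi> n a) \<longlongrightarrow> 0) F"
  proof (rule tendstoI)
    fix e :: real assume e: "e > 0"
    have "(\<lambda>m. K * op_norm X (s m - a)) \<longlonglongrightarrow> 0"
      using tendsto_mult_left[OF lim, of K] by simp
    from LIMSEQ_D[OF this, of "e / 2"] e
    obtain m where "\<forall>n\<ge>m. norm (K * op_norm X (s n - a) - 0) < e / 2"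
      by auto
    then have m: "K * op_norm X (s m - a) < e / 2" by auto
    have "((\<lambda>n. \<Phi> n (s m)) \<longlongrightarrow> 0) F" using s[of m] by simp
    then have "\<forall>\<^sub>F n in F. dist (\<Phi> n (s m)) 0 < e / 2"
      by (rule tendstoD) (use e in simp)
    then show "\<forall>\<^sub>F n in F. dist (\<Phi> n a) 0 < e"
    proof eventually_elim
      case (elim n)
      have "\<Phi> n (s m - a) = \<Phi> n (s m) - \<Phi> n a"
        using add[OF sA closed_subspaceD(4)[OF A aA]] scale[OF aA] by (simp add: op_minus_eq_add_scale)
      then have "\<Phi> n a = \<Phi> n (s m) - \<Phi> n (s m - a)" by (simp add: algebra_simps)
      then have "cmod (\<Phi> n a) \<le> cmod (\<Phi> n (s m)) + cmod (\<Phi> n (s m - a))"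
        by (simp only: norm_triangle_ineq4)
      also have "cmod (\<Phi> n (s m - a)) \<le> K * op_norm X (s m - a)"
        by (rule bound[OF closed_subspace_diff[OF A sA aA]])
      finally show ?case using elim m by simp
    qed
  qed
  with aA show "a \<in> {a \<in> A. ((\<lambda>n. \<Phi> n a) \<longlongrightarrow> 0) F}" by simp
qed

text \<open>Multilinearity lets the slots be passed one at a time from the generators \<open>M\<close> to \<open>A\<close>.\<close>

lemma (in unital_star_endomorphism) mixing_of_order_from_generators:
  assumes gen: "\<And>V. closed_subspace X V \<Longrightarrow> M \<subseteq> V \<Longrightarrow> A \<subseteq> V" and M: "M \<subseteq> A"
    and E: "linear_map_on A E" "\<And>a. a \<in> A \<Longrightarrow> E a \<in> A" "\<And>a. a \<in> A \<Longrightarrow> op_norm X (E a) \<le> op_norm X a"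
    and S: "\<And>\<phi>. \<phi> \<in> S \<Longrightarrow> bounded_functional X A \<phi>"
    and base: "\<And>a p \<phi>. (\<And>i. i \<in> {1..k} \<Longrightarrow> a i \<in> M) \<Longrightarrow> p permutes {1..k} \<Longrightarrow> \<phi> \<in> S \<Longrightarrow>
      ((\<lambda>n. \<phi> (ordered_product X k (\<lambda>i. (\<theta> ^^ n (p i)) (a i)) -
               ordered_product X k (\<lambda>i. (\<theta> ^^ n (p i)) (E (a i))))) \<longlongrightarrow> 0) (gaps_at_top k)"
  shows "mixing_of_order X A \<theta> E S k"
  unfolding mixing_of_order_def
proof (intro allI impI)
  fix a p \<phi>
  assume "(\<forall>i\<in>{1..k}. a i \<in> A) \<and> p permutes {1..k} \<and> \<phi> \<in> S"
  then have a: "\<forall>i\<in>{1..k}. a i \<in> A" and p: "p permutes {1..k}" and \<phi>S: "\<phi> \<in> S" by auto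
  have \<phi>: "\<And>a b. a \<in> A \<Longrightarrow> b \<in> A \<Longrightarrow> \<phi> (a + b) = \<phi> a + \<phi> b"
    "\<And>c a. a \<in> A \<Longrightarrow> \<phi> (op_scale c a) = c * \<phi> a"
    and "\<exists>C. \<forall>a\<in>A. cmod (\<phi> a) \<le> C * op_norm X a"
    using S[OF \<phi>S] by (auto simp: bounded_functional_def)
  then obtain C0 where C0: "\<And>a. a \<in> A \<Longrightarrow> cmod (\<phi> a) \<le> C0 * op_norm X a" by blast
  \<comment> \<open>The absolute value makes the constant nonnegative, as the monotonicity arguments
    below require.\<close>
  define C where "C = \<bar>C0\<bar>"
  have C: "cmod (\<phi> a) \<le> C * op_norm X a" if "a \<in> A" for a
  proof -
    have "C0 * op_norm X a \<le> C * op_norm X a"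
      unfolding C_def by (intro mult_right_mono op_norm_nonneg A_bounded that) simp
    then show ?thesis using C0[OF that] by linarith
  qed
  have \<phi>_diff: "\<phi> (a - b) = \<phi> a - \<phi> b" if "a \<in> A" "b \<in> A" for a b
    using that \<phi>(1)[OF that(1) closed_subspaceD(4)[OF A_closed_subspace that(2)], of "- 1"] \<phi>(2)[OF that(2)]
    by (simp add: op_minus_eq_add_scale)
  define D where "D a n = \<phi> (ordered_product X k (\<lambda>i. (\<theta> ^^ n (p i)) (a i)) -
               ordered_product X k (\<lambda>i. (\<theta> ^^ n (p i)) (E (a i))))" for a and n :: "nat \<Rightarrow> nat"
  have E_add: "E (u + v) = E u + E v" if "u \<in> A" "v \<in> A" for u v
    using E(1) that by (auto simp: linear_map_on_def)
  have E_scale: "E (op_scale c u) = op_scale c (E u)" if "u \<in> A" for c u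
    using E(1) that by (auto simp: linear_map_on_def)
  have closed_slot: "closed_subspace X {u \<in> A. (D (a(j := u)) \<longlongrightarrow> 0) (gaps_at_top k)}"
    if a: "\<And>i. i \<in> {1..k} \<Longrightarrow> a i \<in> A" and j: "j \<in> {1..k}" for a j
  proof -
    obtain C1 where C1: "\<And>m. \<exists>P\<in>A. \<exists>Q\<in>A. op_norm X P * op_norm X Q \<le> C1 \<and>
        (\<forall>u\<in>A. ordered_product X k (\<lambda>i. (\<theta> ^^ m i) ((a(j := u)) i)) = P \<circ> ((\<theta> ^^ m j) u \<circ> Q))"
      using ordered_product_slot[of k a j, OF a j] by blast
    have Ea: "E (a i) \<in> A" if "i \<in> {1..k}" for i using E(2) a that by blast
    obtain C2 where C2: "\<And>m. \<exists>P\<in>A. \<exists>Q\<in>A. op_norm X P * op_norm X Q \<le> C2 \<and>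
        (\<forall>u\<in>A. ordered_product X k (\<lambda>i. (\<theta> ^^ m i) (((\<lambda>i. E (a i))(j := u)) i)) = P \<circ> ((\<theta> ^^ m j) u \<circ> Q))"
      using ordered_product_slot[of k "\<lambda>i. E (a i)" j, OF Ea j] by blast
    have slot: "\<exists>P\<in>A. \<exists>Q\<in>A. \<exists>P'\<in>A. \<exists>Q'\<in>A. op_norm X P * op_norm X Q \<le> C1 \<and>
        op_norm X P' * op_norm X Q' \<le> C2 \<and>
        (\<forall>u\<in>A. D (a(j := u)) n = \<phi> (P \<circ> ((\<theta> ^^ n (p j)) u \<circ> Q)) - \<phi> (P' \<circ> ((\<theta> ^^ n (p j)) (E u) \<circ> Q')))" for n
    proof -
      obtain P Q where PQ: "P \<in> A" "Q \<in> A" "op_norm X P * op_norm X Q \<le> C1"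
        "\<forall>u\<in>A. ordered_product X k (\<lambda>i. (\<theta> ^^ n (p i)) ((a(j := u)) i)) = P \<circ> ((\<theta> ^^ n (p j)) u \<circ> Q)"
        using C1[of "\<lambda>i. n (p i)"] by blast
      obtain P' Q' where PQ': "P' \<in> A" "Q' \<in> A" "op_norm X P' * op_norm X Q' \<le> C2"
        "\<forall>u\<in>A. ordered_product X k (\<lambda>i. (\<theta> ^^ n (p i)) (((\<lambda>i. E (a i))(j := u)) i)) = P' \<circ> ((\<theta> ^^ n (p j)) u \<circ> Q')"
        using C2[of "\<lambda>i. n (p i)"] by blast
      have "D (a(j := u)) n = \<phi> (P \<circ> ((\<theta> ^^ n (p j)) u \<circ> Q)) - \<phi> (P' \<circ> ((\<theta> ^^ n (p j)) (E u) \<circ> Q'))"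
        if u: "u \<in> A" for u
      proof -
        \<comment> \<open>Applying \<open>E\<close> factorwise commutes with overwriting slot
          \<open>j\<close>, so the second product also factors around that slot, with frozen factors
          \<open>E (a i)\<close>.\<close>
        have "(\<lambda>i. (\<theta> ^^ n (p i)) (E ((a(j := u)) i))) = (\<lambda>i. (\<theta> ^^ n (p i)) (((\<lambda>i. E (a i))(j := E u)) i))"
          by auto
        then have "D (a(j := u)) n = \<phi> ((P \<circ> ((\<theta> ^^ n (p j)) u \<circ> Q)) - (P' \<circ> ((\<theta> ^^ n (p j)) (E u) \<circ> Q')))"
          unfolding D_def using bspec[OF PQ(4) u] bspec[OF PQ'(4) E(2)[OF u]] by presburger
        also have "\<dots> = \<phi> (P \<circ> ((\<theta> ^^ n (p j)) u \<circ> Q)) - \<phi> (P' \<circ> ((\<theta> ^^ n (p j)) (E u) \<circ> Q'))"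
          by (intro \<phi>_diff cstar_subalgebraD(2)[OF A] PQ PQ' funpow_closed u E(2))
        finally show ?thesis .
      qed
      with PQ PQ' show ?thesis by blast
    qed
    have comp_in: "P \<circ> (v \<circ> Q) \<in> A" if "P \<in> A" "v \<in> A" "Q \<in> A" for P v Q
      by (intro cstar_subalgebraD(2)[OF A] that)
    have comp_add: "P \<circ> ((v + w) \<circ> Q) = (P \<circ> (v \<circ> Q)) + (P \<circ> (w \<circ> Q))"
      if "P \<in> A" "v \<in> A" "w \<in> A" "Q \<in> A" for P v w Q
      unfolding comp_add_left by (intro comp_add_right[of _ X] bounded_ops_comp A_bounded that)
    have comp_scale: "P \<circ> (op_scale c v \<circ> Q) = op_scale c (P \<circ> (v \<circ> Q))"
      if "P \<in> A" "v \<in> A" "Q \<in> A" for P v Q c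
      unfolding comp_scale_left by (intro comp_scale_right[of _ X] bounded_ops_comp A_bounded that)
    have comp_norm: "cmod (\<phi> (P \<circ> (v \<circ> Q))) \<le> C * (op_norm X P * op_norm X Q) * op_norm X v"
      if "P \<in> A" "v \<in> A" "Q \<in> A" for P v Q
    proof -
      have "cmod (\<phi> (P \<circ> (v \<circ> Q))) \<le> C * op_norm X (P \<circ> (v \<circ> Q))"
        by (rule C[OF comp_in[OF that]])
      also have "\<dots> \<le> C * (op_norm X P * (op_norm X v * op_norm X Q))"
      proof (rule mult_left_mono)
        have "op_norm X (P \<circ> (v \<circ> Q)) \<le> op_norm X P * op_norm X (v \<circ> Q)"
          by (intro op_norm_comp bounded_ops_comp A_bounded that)
        also have "\<dots> \<le> op_norm X P * (op_norm X v * op_norm X Q)"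
          by (rule mult_left_mono[OF op_norm_comp[OF A_bounded[OF that(2)] A_bounded[OF that(3)]]
                op_norm_nonneg[OF A_bounded[OF that(1)]]])
        finally show "op_norm X (P \<circ> (v \<circ> Q)) \<le> op_norm X P * (op_norm X v * op_norm X Q)" .
      qed (simp add: C_def)
      finally show ?thesis by (simp only: mult_ac)
    qed
    \<comment> \<open>\<open>C * C1\<close> and \<open>C * C2\<close> bound the two products
      separately; neither \<open>E\<close> nor an iterate of \<theta> increases the norm of the
      entry in the slot.\<close>
    show ?thesis
    proof (rule closed_subspace_null_limits[OF A_closed_subspace, of "\<lambda>n u. D (a(j := u)) n" "C * C1 + C * C2"])
      fix n u v assume u: "u \<in> A" and v: "v \<in> A"
      obtain P Q P' Q' where PQ: "P \<in> A" "Q \<in> A" "P' \<in> A" "Q' \<in> A" and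
        D: "\<And>u. u \<in> A \<Longrightarrow> D (a(j := u)) n = \<phi> (P \<circ> ((\<theta> ^^ n (p j)) u \<circ> Q)) - \<phi> (P' \<circ> ((\<theta> ^^ n (p j)) (E u) \<circ> Q'))"
        using slot[of n] by blast
      note uv = funpow_closed[OF u] funpow_closed[OF v] funpow_closed[OF E(2)[OF u]] funpow_closed[OF E(2)[OF v]]
      show "D (a(j := u + v)) n = D (a(j := u)) n + D (a(j := v)) n"
        unfolding D[OF closed_subspaceD(3)[OF A_closed_subspace u v]] D[OF u] D[OF v] E_add[OF u v]
          funpow_add[OF u v] funpow_add[OF E(2)[OF u] E(2)[OF v]]
          comp_add[OF PQ(1) uv(1,2) PQ(2)] comp_add[OF PQ(3) uv(3,4) PQ(4)]
          \<phi>(1)[OF comp_in[OF PQ(1) uv(1) PQ(2)] comp_in[OF PQ(1) uv(2) PQ(2)]]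
          \<phi>(1)[OF comp_in[OF PQ(3) uv(3) PQ(4)] comp_in[OF PQ(3) uv(4) PQ(4)]]
        by simp
    next
      fix n c u assume u: "u \<in> A"
      obtain P Q P' Q' where PQ: "P \<in> A" "Q \<in> A" "P' \<in> A" "Q' \<in> A" and
        D: "\<And>u. u \<in> A \<Longrightarrow> D (a(j := u)) n = \<phi> (P \<circ> ((\<theta> ^^ n (p j)) u \<circ> Q)) - \<phi> (P' \<circ> ((\<theta> ^^ n (p j)) (E u) \<circ> Q'))"
        using slot[of n] by blast
      note uv = funpow_closed[OF u] funpow_closed[OF E(2)[OF u]]
      show "D (a(j := op_scale c u)) n = c * D (a(j := u)) n"
        unfolding D[OF closed_subspaceD(4)[OF A_closed_subspace u]] D[OF u] E_scale[OF u]
          funpow_scale[OF u] funpow_scale[OF E(2)[OF u]]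
          comp_scale[OF PQ(1) uv(1) PQ(2)] comp_scale[OF PQ(3) uv(2) PQ(4)]
          \<phi>(2)[OF comp_in[OF PQ(1) uv(1) PQ(2)]] \<phi>(2)[OF comp_in[OF PQ(3) uv(2) PQ(4)]]
        by (simp add: right_diff_distrib)
    next
      fix n u assume u: "u \<in> A"
      obtain P Q P' Q' where PQ: "P \<in> A" "Q \<in> A" "P' \<in> A" "Q' \<in> A"
        and bounds: "op_norm X P * op_norm X Q \<le> C1" "op_norm X P' * op_norm X Q' \<le> C2" and
        D: "\<And>u. u \<in> A \<Longrightarrow> D (a(j := u)) n = \<phi> (P \<circ> ((\<theta> ^^ n (p j)) u \<circ> Q)) - \<phi> (P' \<circ> ((\<theta> ^^ n (p j)) (E u) \<circ> Q'))"
        using slot[of n] by blast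
      have le: "cmod (\<phi> (P \<circ> (v \<circ> Q))) \<le> C * c * op_norm X u"
        if "P \<in> A" "Q \<in> A" "v \<in> A" "op_norm X P * op_norm X Q \<le> c" "op_norm X v \<le> op_norm X u" for P Q v c
      proof -
        have "0 \<le> op_norm X P * op_norm X Q"
          by (intro mult_nonneg_nonneg op_norm_nonneg A_bounded that)
        then have "C * (op_norm X P * op_norm X Q) * op_norm X v \<le> C * c * op_norm X u"
          using that(4,5) op_norm_nonneg[OF A_bounded[OF that(3)]]
          by (intro mult_mono) (auto simp: C_def)
        then show ?thesis using comp_norm[OF that(1,3,2)] by linarith
      qed
      have "cmod (D (a(j := u)) n) \<le> cmod (\<phi> (P \<circ> ((\<theta> ^^ n (p j)) u \<circ> Q))) + cmod (\<phi> (P' \<circ> ((\<theta> ^^ n (p j)) (E u) \<circ> Q')))"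
        unfolding D[OF u] by (rule norm_triangle_ineq4)
      also have "\<dots> \<le> C * C1 * op_norm X u + C * C2 * op_norm X u"
        by (intro add_mono le PQ bounds funpow_closed u E(2) funpow_contractive
            order_trans[OF funpow_contractive[OF E(2)[OF u]] E(3)[OF u]])
      finally show "cmod (D (a(j := u)) n) \<le> (C * C1 + C * C2) * op_norm X u"
        by (simp add: distrib_right)
    qed
  qed
  \<comment> \<open>\<open>J\<close> collects the slots that may hold any element of
    \<open>A\<close>, the others holding generators. To add \<open>j\<close>, the induction
    hypothesis treats generators in slot \<open>j\<close>, and the closed subspace above extends
    this to \<open>A\<close>.\<close>
  have "(D a \<longlongrightarrow> 0) (gaps_at_top k)"
    if "finite J" "J \<subseteq> {1..k}" "\<forall>i\<in>{1..k}. a i \<in> A" "\<forall>i\<in>{1..k} - J. a i \<in> M" for J a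
    using that
  proof (induction J arbitrary: a rule: finite_induct)
    case empty
    then show ?case
      unfolding D_def using base[of a p \<phi>] p \<phi>S by simp
  next
    case (insert j J)
    have j: "j \<in> {1..k}" using insert.prems by simp
    have aA: "a i \<in> A" if "i \<in> {1..k}" for i
      using insert.prems(2) that by blast
    have "M \<subseteq> {u \<in> A. (D (a(j := u)) \<longlongrightarrow> 0) (gaps_at_top k)}"
    proof
      fix u assume u: "u \<in> M"
      have "(D (a(j := u)) \<longlongrightarrow> 0) (gaps_at_top k)"
        by (rule insert.IH) (use insert.prems u M in auto)
      with u M show "u \<in> {u \<in> A. (D (a(j := u)) \<longlongrightarrow> 0) (gaps_at_top k)}" by blast
    qed
    then have "A \<subseteq> {u \<in> A. (D (a(j := u)) \<longlongrightarrow> 0) (gaps_at_top k)}"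
      using gen[OF closed_slot[of a j, OF aA j]] by blast
    then have "(D (a(j := a j)) \<longlongrightarrow> 0) (gaps_at_top k)"
      using aA[OF j] by blast
    then show ?case by simp
  qed
  from this[of "{1..k}" a] have "(D a \<longlongrightarrow> 0) (gaps_at_top k)"
    using a by simp
  then show "((\<lambda>n. \<phi> (ordered_product X k (\<lambda>i. (\<theta> ^^ n (p i)) (a i)) -
               ordered_product X k (\<lambda>i. (\<theta> ^^ n (p i)) (E (a i))))) \<longlongrightarrow> 0) (gaps_at_top k)"
    unfolding D_def .
qed

section \<open>Mixing for products of group elements, and its extension to the reduced
  algebra\<close>

theorem theorem5p2:
  fixes L :: "'a set"
    and \<sigma> :: "'a \<Rightarrow> 'a"
    and \<alpha> E :: "'a letter list op \<Rightarrow> 'a letter list op"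
  assumes "bij_betw \<sigma> L L"
    and "is_dual_automorphism (free_group L) (free_group_map \<sigma>) \<alpha>"
    and "conditional_expectation (carrier (free_group L)) (reduced_cstar (free_group L))
           (finite_orbit_algebra (free_group L) (free_group_map \<sigma>)) E"
    and "\<And>g. g \<in> finite_orbit_points (free_group L) (free_group_map \<sigma>) \<Longrightarrow>
           E (reg_rep (free_group L) g) = reg_rep (free_group L) g"
    and "\<And>g. g \<in> carrier (free_group L) - finite_orbit_points (free_group L) (free_group_map \<sigma>) \<Longrightarrow>
           E (reg_rep (free_group L) g) = 0"
  shows "mixing_of_all_orders (carrier (free_group L)) (reduced_cstar (free_group L)) \<alpha> E
           (density_states (carrier (free_group L)) (reduced_cstar (free_group L)))"
proof -
  let ?G = "free_group L"
  let ?T = "free_group_map \<sigma>"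
  let ?X = "carrier ?G"
  let ?A = "reduced_cstar ?G"
  let ?M = "reg_rep ?G ` ?X"
  let ?F = "finite_orbit_points ?G ?T"
  let ?mul = "\<lambda>gs. foldr (\<otimes>\<^bsub>?G\<^esub>) gs \<one>\<^bsub>?G\<^esub>"
  interpret group ?G by (rule group_free_group)
  interpret M: star_semigroup ?X ?M by (rule star_semigroup_reg_rep)
  have \<alpha>_rep: "\<alpha> (reg_rep ?G g) = reg_rep ?G (?T g)" if "g \<in> ?X" for g
    using assms(2) that by (simp add: is_dual_automorphism_def)
  have T_closed: "(?T ^^ n) g \<in> ?X" if "g \<in> ?X" for g n
    by (rule free_group_map_funpow_closed[OF assms(1) that])
  have star: "star_automorphism ?X ?A \<alpha>"
    using assms(2) by (simp add: is_dual_automorphism_def)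
  interpret unital_star_endomorphism ?X ?A \<alpha>
  proof
    show "cstar_subalgebra ?X ?A" by (rule cstar_subalgebra_reduced_cstar)
    show "id_op ?X \<in> ?A" by (rule id_op_in_reduced_cstar)
    show "\<exists>b. is_adjoint ?X a b" if "a \<in> ?A" for a
      using M.generated_cstar_adjoint[of a] that unfolding reduced_cstar_def by blast
    show "\<alpha> a \<in> ?A" if "a \<in> ?A" for a
      using star that bij_betwE unfolding star_automorphism_def by blast
    show "linear_map_on ?A \<alpha>" using star unfolding star_automorphism_def by blast
    show "\<alpha> (a \<circ> b) = \<alpha> a \<circ> \<alpha> b" if "a \<in> ?A" "b \<in> ?A" for a b
      using star that unfolding star_automorphism_def by blast
    show "is_adjoint ?X (\<alpha> a) (\<alpha> b)" if "a \<in> ?A" "is_adjoint ?X a b" for a b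
      using star that unfolding star_automorphism_def by blast
    \<comment> \<open>Unitality comes from the group: the empty word is fixed and is represented by
      the identity operator.\<close>
    have "?T \<one>\<^bsub>?G\<^esub> = \<one>\<^bsub>?G\<^esub>" by (simp add: free_group_def free_group_map_def)
    then show "\<alpha> (id_op ?X) = id_op ?X"
      using \<alpha>_rep[OF one_closed] by (simp add: reg_rep_one)
  qed
  have E: "linear_map_on ?A E" "\<And>a. a \<in> ?A \<Longrightarrow> op_norm ?X (E a) \<le> op_norm ?X a"
    using assms(3) unfolding conditional_expectation_def by blast+
  \<comment> \<open>\<open>E\<close> takes values in the finite orbit algebra; the inclusion makes
    these values admissible factors for \<alpha>.\<close>
  have "finite_orbit_algebra ?G ?T \<subseteq> ?A"
    unfolding finite_orbit_algebra_def
    by (rule generated_cstar_subset[OF cstar_subalgebra_reduced_cstar])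
      (auto simp: finite_orbit_points_def intro: reg_rep_in_reduced_cstar)
  then have E_closed: "E a \<in> ?A" if "a \<in> ?A" for a
    using assms(3) that unfolding conditional_expectation_def by blast
  have \<alpha>_pow_rep: "(\<alpha> ^^ n) (reg_rep ?G g) = reg_rep ?G ((?T ^^ n) g)" if "g \<in> ?X" for g n
    using that by (induction n) (simp_all add: \<alpha>_rep T_closed)
  have \<alpha>_pow_zero: "(\<alpha> ^^ n) 0 = 0" for n
    using funpow_add[of 0 0 n] closed_subspaceD(2)[OF A_closed_subspace] by simp
  show ?thesis
    unfolding mixing_of_all_orders_def
  proof (intro allI impI mixing_of_order_from_generators[where M = ?M] E E_closed)
    show "?A \<subseteq> V" if "closed_subspace ?X V" "?M \<subseteq> V" for V
      unfolding reduced_cstar_def by (rule M.generated_cstar_subset_closed_subspace[OF that])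
    show "?M \<subseteq> ?A" by (auto intro: reg_rep_in_reduced_cstar)
    show "bounded_functional ?X ?A \<phi>" if "\<phi> \<in> density_states ?X ?A" for \<phi>
      using that by (simp add: density_states_def state_def)
  next
    fix k :: nat and a p \<phi>
    assume a: "\<And>i. i \<in> {1..k} \<Longrightarrow> a i \<in> ?M" and p: "p permutes {1..k}"
      and \<phi>: "\<phi> \<in> density_states ?X ?A"
    obtain \<rho> where \<rho>: "density_matrix ?X \<rho>" "\<And>a. a \<in> ?A \<Longrightarrow> \<phi> a = op_trace ?X (\<rho> \<circ> a)"
      using \<phi> by (auto simp: density_states_def)
    have aA: "a i \<in> ?A" if "i \<in> {1..k}" for i
      using a[OF that] reg_rep_in_reduced_cstar by auto
    have "\<forall>i\<in>{1..k}. \<exists>x. x \<in> ?X \<and> a i = reg_rep ?G x"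
      using a by blast
    from bchoice[OF this] obtain g where "\<forall>i\<in>{1..k}. g i \<in> ?X \<and> a i = reg_rep ?G (g i)" ..
    then have g: "\<And>i. i \<in> {1..k} \<Longrightarrow> g i \<in> ?X" "\<And>i. i \<in> {1..k} \<Longrightarrow> a i = reg_rep ?G (g i)"
      by blast+
    let ?P = "\<lambda>n. ordered_product ?X k (\<lambda>i. (\<alpha> ^^ n (p i)) (a i))"
    let ?P' = "\<lambda>n. ordered_product ?X k (\<lambda>i. (\<alpha> ^^ n (p i)) (E (a i)))"
    show "((\<lambda>n. \<phi> (?P n - ?P' n)) \<longlongrightarrow> 0) (gaps_at_top k)"
    proof (cases "\<forall>i\<in>{1..k}. g i \<in> ?F")
      case True
      have "?P n = ?P' n" for n
        unfolding ordered_product_def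
        by (rule arg_cong[where f = "\<lambda>bs. foldr (\<circ>) bs _"], rule map_cong)
          (use True g(2) assms(4) in auto)
      \<comment> \<open>The difference of the two products is the operator 0, where \<phi> is
        evaluated by the trace formula.\<close>
      moreover have "\<phi> 0 = 0"
      proof -
        have comp_zero: "\<rho> \<circ> 0 = 0"
          using bounded_ops_0[of \<rho> ?X] \<rho>(1) by (simp add: density_matrix_def positive_op_def fun_eq_iff)
        show ?thesis
          unfolding \<rho>(2)[OF closed_subspaceD(2)[OF A_closed_subspace]] comp_zero
          by (simp add: op_trace_def L2_inner_def)
      qed
      ultimately show ?thesis by simp
    next
      case False
      then obtain i0 where i0: "i0 \<in> {1..k}" "g i0 \<notin> ?F" by blast
      let ?h = "\<lambda>n. ?mul (map (\<lambda>i. (?T ^^ n (p i)) (g i)) [1..<k + 1])"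
      have h: "?h n \<in> ?X" for n
        by (rule foldr_mult_closed) (use g(1) T_closed in auto)
      have P: "?P n = reg_rep ?G (?h n)" for n
      proof -
        have "map (\<lambda>i. (\<alpha> ^^ n (p i)) (a i)) [1..<k + 1]
            = map (reg_rep ?G) (map (\<lambda>i. (?T ^^ n (p i)) (g i)) [1..<k + 1])"
          using g by (auto simp: \<alpha>_pow_rep)
        moreover have "set (map (\<lambda>i. (?T ^^ n (p i)) (g i)) [1..<k + 1]) \<subseteq> ?X"
          using g(1) T_closed by auto
        ultimately show ?thesis
          unfolding ordered_product_def by (simp only: foldr_reg_rep)
      qed
      \<comment> \<open>Overwriting slot \<open>i0\<close> by 0 changes nothing because
        \<open>E (a i0) = 0\<close>, so the factorization around this slot gives
        \<open>P \<circ> (0 \<circ> Q)\<close>.\<close>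
      have P': "?P' n = 0" for n
      proof -
        have Ea: "E (a i) \<in> ?A" if "i \<in> {1..k}" for i by (rule E_closed[OF aA[OF that]])
        have "E (a i0) = 0" using assms(5)[of "g i0"] g[OF i0(1)] i0(2) by simp
        then have upd: "(\<lambda>i. E (a i))(i0 := 0) = (\<lambda>i. E (a i))" by auto
        obtain C where "\<forall>m. \<exists>P\<in>?A. \<exists>Q\<in>?A. op_norm ?X P * op_norm ?X Q \<le> C \<and>
            (\<forall>u\<in>?A. ordered_product ?X k (\<lambda>i. (\<alpha> ^^ m i) (((\<lambda>i. E (a i))(i0 := u)) i)) = P \<circ> ((\<alpha> ^^ m i0) u \<circ> Q))"
          using ordered_product_slot[of k "\<lambda>i. E (a i)" i0, OF Ea i0(1)] ..
        from spec[OF this, of "\<lambda>i. n (p i)"] obtain P Q where P: "P \<in> ?A" and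
          slot: "\<forall>u\<in>?A. ordered_product ?X k (\<lambda>i. (\<alpha> ^^ n (p i)) (((\<lambda>i. E (a i))(i0 := u)) i)) = P \<circ> ((\<alpha> ^^ n (p i0)) u \<circ> Q)"
          by (elim bexE conjE)
        from bspec[OF slot closed_subspaceD(2)[OF A_closed_subspace]]
        have "?P' n = P \<circ> (0 \<circ> Q)"
          unfolding upd \<alpha>_pow_zero .
        then show ?thesis
          using bounded_ops_0[OF A_bounded[OF P]] by (simp add: fun_eq_iff)
      qed
      have "((\<lambda>n. \<phi> (reg_rep ?G (?h n))) \<longlongrightarrow> 0) (gaps_at_top k)"
      proof (rule tendstoI)
        fix e :: real assume e: "e > 0"
        then obtain K where K: "finite K"
          "\<forall>h\<in>?X - K. cmod (op_trace ?X (\<rho> \<circ> reg_rep ?G h)) \<le> e / 2"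
          using density_matrix_vanishes_at_infinity[OF \<rho>(1), of "e / 2"] by auto
        have "\<forall>\<^sub>F n in gaps_at_top k. \<forall>w\<in>K. ?h n \<noteq> w"
          by (intro eventually_ball_finite K ballI eventually_product_neq[where g = g, OF assms(1) p g(1) i0])
        then show "\<forall>\<^sub>F n in gaps_at_top k. dist (\<phi> (reg_rep ?G (?h n))) 0 < e"
        proof eventually_elim
          case (elim n)
          then have "?h n \<in> ?X - K" using h by blast
          then have "cmod (op_trace ?X (\<rho> \<circ> reg_rep ?G (?h n))) \<le> e / 2" using K(2) by blast
          then show ?case
            using \<rho>(2)[OF reg_rep_in_reduced_cstar[OF h]] e by simp
        qed
      qed
      then show ?thesis unfolding P P' by simp
    qed
  qed
qed

end
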